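(* Let $\mathbb F$ be a finitely generated noncyclic free group, $\Phi\colon\mathbb F\to\mathbb F$ an automorphism, and $\mathbb G=\mathbb F\rtimes_\Phi\mathbb Z$. Every slender subgroup of $\mathbb G$ is undistorted in $\mathbb G$.
   Context: $\mathbb F\rtimes_\Phi\mathbb Z=\langle\mathbb F,t\mid txt^{-1}=\Phi(x)\text{ for all }x\in\mathbb F\rangle$. A group is slender if every one of its subgroups is finitely generated. A function $f\colon\Gamma\to\Gamma'$ between connected locally finite graphs with combinatorial metrics $d,d'$ is a quasi-isometric embedding if there is $K\ge1$ with $\frac1K d(p_1,p_2)-K\le d'(f(p_1),f(p_2))\le K d(p_1,p_2)+K$ for all $p_1,p_2\in\Gamma$. A finitely generated subgroup $\mathbb H'$ of a finitely generated group $\mathbb H$ is undistorted if the inclusion extends to a quasi-isometric embedding of Cayley graphs $\mathrm{Cay}(\mathbb H')\to\mathrm{Cay}(\mathbb H)$ (with respect to any finite generating sets). *)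

theory Defs
  imports
    Complex_Main
    "HOL-Algebra.Elementary_Groups"
    "Graph_Theory.Digraph_Component"
begin

section \<open>Finitely generated, slender and free groups\<close>

definition finitely_generated_group :: "('a, 'b) monoid_scheme \<Rightarrow> bool" where
  "finitely_generated_group G \<longleftrightarrow>
     (\<exists>S. finite S \<and> S \<subseteq> carrier G \<and> generate G S = carrier G)"

definition slender :: "('a, 'b) monoid_scheme \<Rightarrow> bool" where
  "slender G \<longleftrightarrow> (\<forall>K. subgroup K G \<longrightarrow> finitely_generated_group (G\<lparr>carrier := K\<rparr>))"

text \<open>A letter \<open>(x, True)\<close> stands for \<open>x\<close>, and \<open>(x, False)\<close> for its formal inverse.\<close>

fun cancelling :: "'a \<times> bool \<Rightarrow> 'a \<times> bool \<Rightarrow> bool" where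
  "cancelling (x, b) (y, c) \<longleftrightarrow> x = y \<and> b \<noteq> c"

definition reduced_words :: "'a set \<Rightarrow> ('a \<times> bool) list set" where
  "reduced_words X =
     {w. set w \<subseteq> X \<times> UNIV \<and> (\<forall>i. Suc i < length w \<longrightarrow> \<not> cancelling (w ! i) (w ! Suc i))}"

definition letter_value :: "('a, 'b) monoid_scheme \<Rightarrow> 'a \<times> bool \<Rightarrow> 'a" where
  "letter_value G l = (if snd l then fst l else inv\<^bsub>G\<^esub> fst l)"

definition word_value :: "('a, 'b) monoid_scheme \<Rightarrow> ('a \<times> bool) list \<Rightarrow> 'a" where
  "word_value G w = foldr (\<lambda>l g. letter_value G l \<otimes>\<^bsub>G\<^esub> g) w \<one>\<^bsub>G\<^esub>"

text \<open>\<open>G\<close> is free with basis \<open>X\<close> if every element is the value of exactly one reduced word in \<open>X\<close>.\<close>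

definition free_basis :: "('a, 'b) monoid_scheme \<Rightarrow> 'a set \<Rightarrow> bool" where
  "free_basis G X \<longleftrightarrow>
     X \<subseteq> carrier G \<and> bij_betw (word_value G) (reduced_words X) (carrier G)"

definition free_group :: "('a, 'b) monoid_scheme \<Rightarrow> bool" where
  "free_group G \<longleftrightarrow> group G \<and> (\<exists>X. free_basis G X)"


section \<open>The group \<open>F \<rtimes>\<^sub>\<Phi> \<int>\<close>\<close>

definition aut_pow :: "('a, 'b) monoid_scheme \<Rightarrow> ('a \<Rightarrow> 'a) \<Rightarrow> int \<Rightarrow> 'a \<Rightarrow> 'a" where
  "aut_pow F \<Phi> n =
     (if 0 \<le> n then \<Phi> ^^ nat n else inv_into (carrier F) \<Phi> ^^ nat (- n))"

text \<open>The pair \<open>(x, n)\<close> stands for \<open>x t\<^sup>n\<close>, and multiplication is dictated by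
  \<open>t\<^sup>m y = \<Phi>\<^sup>m(y) t\<^sup>m\<close>. That this group has the presentation
  \<open>\<langle>F, t | t x t\<^sup>-\<^sup>1 = \<Phi>(x)\<rangle>\<close> is the content of \<open>semidirect_int_relation\<close> and
  \<open>semidirect_int_universal\<close> below.\<close>

definition semidirect_int :: "('a, 'b) monoid_scheme \<Rightarrow> ('a \<Rightarrow> 'a) \<Rightarrow> ('a \<times> int) monoid" where
  "semidirect_int F \<Phi> =
     \<lparr>carrier = carrier F \<times> UNIV,
      monoid.mult = (\<lambda>(x, m) (y, n). (x \<otimes>\<^bsub>F\<^esub> aut_pow F \<Phi> m y, m + n)),
      monoid.one = (\<one>\<^bsub>F\<^esub>, 0)\<rparr>"

lemma semidirect_int_simps [simp]:
  "carrier (semidirect_int F \<Phi>) = carrier F \<times> UNIV"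
  "(x, m) \<otimes>\<^bsub>semidirect_int F \<Phi>\<^esub> (y, n) = (x \<otimes>\<^bsub>F\<^esub> aut_pow F \<Phi> m y, m + n)"
  "\<one>\<^bsub>semidirect_int F \<Phi>\<^esub> = (\<one>\<^bsub>F\<^esub>, 0)"
  by (simp_all add: semidirect_int_def)

context
  fixes F :: "('a, 'b) monoid_scheme" and \<Phi> :: "'a \<Rightarrow> 'a"
  assumes F: "group F" and \<Phi>: "\<Phi> \<in> iso F F"
begin

interpretation F: group F by (rule F)

lemma aut_bij: "bij_betw \<Phi> (carrier F) (carrier F)"
  using \<Phi> by (simp add: iso_def)

lemma aut_inv_iso: "inv_into (carrier F) \<Phi> \<in> iso F F"
  using F.iso_set_sym[OF \<Phi>] .

lemma aut_inv_right: "x \<in> carrier F \<Longrightarrow> \<Phi> (inv_into (carrier F) \<Phi> x) = x"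
  using aut_bij by (meson bij_betw_inv_into_right)

lemma aut_inv_left: "x \<in> carrier F \<Longrightarrow> inv_into (carrier F) \<Phi> (\<Phi> x) = x"
  using aut_bij by (meson bij_betw_inv_into_left)

lemma iso_funpow: "f \<in> iso F F \<Longrightarrow> f ^^ n \<in> iso F F"
proof (induction n)
  case 0
  show ?case by (simp add: iso_def hom_def bij_betw_def)
next
  case (Suc n)
  have "f \<circ> (f ^^ n) \<in> hom F F"
    using Group.hom_compose[of "f ^^ n" F F f F] Suc by (auto simp: iso_def)
  moreover have "bij_betw (f \<circ> (f ^^ n)) (carrier F) (carrier F)"
    using Suc by (auto simp: iso_def intro: bij_betw_trans)
  ultimately show ?case unfolding iso_def funpow.simps by blast
qed

lemma aut_pow_iso: "aut_pow F \<Phi> n \<in> iso F F"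
  by (simp add: aut_pow_def iso_funpow \<Phi> aut_inv_iso)

lemma aut_pow_closed [simp]: "x \<in> carrier F \<Longrightarrow> aut_pow F \<Phi> n x \<in> carrier F"
  using aut_pow_iso[of n] by (auto simp: iso_def hom_def)

lemma aut_pow_mult:
  "x \<in> carrier F \<Longrightarrow> y \<in> carrier F \<Longrightarrow>
     aut_pow F \<Phi> n (x \<otimes>\<^bsub>F\<^esub> y) = aut_pow F \<Phi> n x \<otimes>\<^bsub>F\<^esub> aut_pow F \<Phi> n y"
  using aut_pow_iso[of n] by (auto simp: iso_def hom_def)

lemma aut_pow_0 [simp]: "aut_pow F \<Phi> 0 x = x"
  by (simp add: aut_pow_def)

lemma aut_pow_1 [simp]: "aut_pow F \<Phi> 1 x = \<Phi> x"
  by (simp add: aut_pow_def)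

lemma aut_pow_Suc:
  assumes "x \<in> carrier F"
  shows "aut_pow F \<Phi> (n + 1) x = \<Phi> (aut_pow F \<Phi> n x)"
proof (cases "0 \<le> n")
  case True
  then have "nat (n + 1) = Suc (nat n)" by simp
  then show ?thesis using True by (simp add: aut_pow_def)
next
  case False
  define k where "k = nat (- (n + 1))"
  have k: "nat (- n) = Suc k" using False by (simp add: k_def)
  have c: "(inv_into (carrier F) \<Phi> ^^ k) x \<in> carrier F"
    using iso_funpow[OF aut_inv_iso, of k] assms by (auto simp: iso_def hom_def)
  have "aut_pow F \<Phi> (n + 1) x = (inv_into (carrier F) \<Phi> ^^ k) x"
    using False by (cases "n = -1") (auto simp: aut_pow_def k_def)
  then show ?thesis
    using False k aut_inv_right[OF c] by (simp add: aut_pow_def)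
qed

lemma aut_pow_pred:
  assumes "x \<in> carrier F"
  shows "aut_pow F \<Phi> (n - 1) x = inv_into (carrier F) \<Phi> (aut_pow F \<Phi> n x)"
  using aut_pow_Suc[OF assms, of "n - 1"] aut_inv_left[of "aut_pow F \<Phi> (n - 1) x"] assms
  by simp

lemma aut_pow_add:
  assumes "x \<in> carrier F"
  shows "aut_pow F \<Phi> (m + n) x = aut_pow F \<Phi> m (aut_pow F \<Phi> n x)"
proof (induction m rule: int_induct[where k = 0])
  case base
  show ?case by simp
next
  case (step1 i)
  then show ?case
    using aut_pow_Suc[OF assms, of "i + n"] aut_pow_Suc[of "aut_pow F \<Phi> n x" i] assms
    by (simp add: algebra_simps)
next
  case (step2 i)
  then show ?case
    using aut_pow_pred[OF assms, of "i + n"] aut_pow_pred[of "aut_pow F \<Phi> n x" i] assms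
    by (simp add: algebra_simps)
qed

lemma semidirect_int_group: "group (semidirect_int F \<Phi>)"
proof (rule groupI)
  show "x \<otimes>\<^bsub>semidirect_int F \<Phi>\<^esub> y \<in> carrier (semidirect_int F \<Phi>)"
    if "x \<in> carrier (semidirect_int F \<Phi>)" "y \<in> carrier (semidirect_int F \<Phi>)" for x y
    using that by (cases x; cases y) auto
  show "\<one>\<^bsub>semidirect_int F \<Phi>\<^esub> \<in> carrier (semidirect_int F \<Phi>)" by simp
  show "x \<otimes>\<^bsub>semidirect_int F \<Phi>\<^esub> y \<otimes>\<^bsub>semidirect_int F \<Phi>\<^esub> z =
        x \<otimes>\<^bsub>semidirect_int F \<Phi>\<^esub> (y \<otimes>\<^bsub>semidirect_int F \<Phi>\<^esub> z)"
    if "x \<in> carrier (semidirect_int F \<Phi>)" "y \<in> carrier (semidirect_int F \<Phi>)"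
      "z \<in> carrier (semidirect_int F \<Phi>)" for x y z
    using that by (cases x; cases y; cases z) (auto simp: aut_pow_mult aut_pow_add F.m_assoc)
  show "\<one>\<^bsub>semidirect_int F \<Phi>\<^esub> \<otimes>\<^bsub>semidirect_int F \<Phi>\<^esub> x = x"
    if "x \<in> carrier (semidirect_int F \<Phi>)" for x
    using that by (cases x) auto
  show "\<exists>y\<in>carrier (semidirect_int F \<Phi>). y \<otimes>\<^bsub>semidirect_int F \<Phi>\<^esub> x = \<one>\<^bsub>semidirect_int F \<Phi>\<^esub>"
    if "x \<in> carrier (semidirect_int F \<Phi>)" for x
  proof -
    obtain a n where x: "x = (a, n)" "a \<in> carrier F"
      using \<open>x \<in> carrier (semidirect_int F \<Phi>)\<close> by (cases x) auto
    show ?thesis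
      by (rule bexI[of _ "(inv\<^bsub>F\<^esub> (aut_pow F \<Phi> (- n) a), - n)"]) (use x in auto)
  qed
qed

lemma semidirect_int_embedding: "(\<lambda>x. (x, 0)) \<in> hom F (semidirect_int F \<Phi>)"
  by (auto simp: hom_def)

lemma semidirect_int_relation:
  assumes "x \<in> carrier F"
  shows "(\<one>\<^bsub>F\<^esub>, 1) \<otimes>\<^bsub>semidirect_int F \<Phi>\<^esub> (x, 0) \<otimes>\<^bsub>semidirect_int F \<Phi>\<^esub>
           inv\<^bsub>semidirect_int F \<Phi>\<^esub> (\<one>\<^bsub>F\<^esub>, 1) = (\<Phi> x, 0)"
proof -
  interpret G: group "semidirect_int F \<Phi>" by (rule semidirect_int_group)
  have "\<Phi> x \<in> carrier F" using aut_pow_closed[OF assms, of 1] by simp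
  moreover have "aut_pow F \<Phi> n \<one>\<^bsub>F\<^esub> = \<one>\<^bsub>F\<^esub>" for n
    using aut_pow_mult[of "\<one>\<^bsub>F\<^esub>" "\<one>\<^bsub>F\<^esub>" n] F.l_cancel_one'[of "aut_pow F \<Phi> n \<one>\<^bsub>F\<^esub>" "aut_pow F \<Phi> n \<one>\<^bsub>F\<^esub>"] by simp
  ultimately have "(\<one>\<^bsub>F\<^esub>, 1) \<otimes>\<^bsub>semidirect_int F \<Phi>\<^esub> (x, 0) =
      (\<Phi> x, 0) \<otimes>\<^bsub>semidirect_int F \<Phi>\<^esub> (\<one>\<^bsub>F\<^esub>, 1)"
    using assms by simp
  moreover have "p \<in> carrier (semidirect_int F \<Phi>) \<Longrightarrow> q \<in> carrier (semidirect_int F \<Phi>) \<Longrightarrow>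
      p \<otimes>\<^bsub>semidirect_int F \<Phi>\<^esub> q \<otimes>\<^bsub>semidirect_int F \<Phi>\<^esub> inv\<^bsub>semidirect_int F \<Phi>\<^esub> q = p" for p q
    by (simp add: G.m_assoc del: semidirect_int_simps)
  from this[of "(\<Phi> x, 0)" "(\<one>\<^bsub>F\<^esub>, 1)"]
  have "(\<Phi> x, 0) \<otimes>\<^bsub>semidirect_int F \<Phi>\<^esub> (\<one>\<^bsub>F\<^esub>, 1) \<otimes>\<^bsub>semidirect_int F \<Phi>\<^esub>
      inv\<^bsub>semidirect_int F \<Phi>\<^esub> (\<one>\<^bsub>F\<^esub>, 1) = (\<Phi> x, 0)"
    using \<open>\<Phi> x \<in> carrier F\<close> unfolding semidirect_int_simps(1) by blast
  ultimately show ?thesis by (simp only:)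
qed

lemma semidirect_int_universal:
  fixes H :: "('c, 'd) monoid_scheme"
  assumes H: "group H" and f: "f \<in> hom F H" and u: "u \<in> carrier H"
    and rel: "\<And>x. x \<in> carrier F \<Longrightarrow> u \<otimes>\<^bsub>H\<^esub> f x \<otimes>\<^bsub>H\<^esub> inv\<^bsub>H\<^esub> u = f (\<Phi> x)"
  shows "\<exists>!g. g \<in> hom (semidirect_int F \<Phi>) H \<inter> extensional (carrier F \<times> UNIV) \<and>
           (\<forall>x\<in>carrier F. g (x, 0) = f x) \<and> g (\<one>\<^bsub>F\<^esub>, 1) = u"
proof -
  interpret H: group H by (rule H)
  interpret G: group "semidirect_int F \<Phi>" by (rule semidirect_int_group)
  have fc [simp]: "x \<in> carrier F \<Longrightarrow> f x \<in> carrier H" for x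
    using f by (auto simp: hom_def)
  have fm: "x \<in> carrier F \<Longrightarrow> y \<in> carrier F \<Longrightarrow> f (x \<otimes>\<^bsub>F\<^esub> y) = f x \<otimes>\<^bsub>H\<^esub> f y" for x y
    using f by (auto simp: hom_def)
  have f1: "f \<one>\<^bsub>F\<^esub> = \<one>\<^bsub>H\<^esub>"
    using hom_one[OF f F H] .
  have \<Phi>c [simp]: "x \<in> carrier F \<Longrightarrow> \<Phi> x \<in> carrier F" for x
    using aut_pow_closed[of x 1] by simp
  have r: "u \<otimes>\<^bsub>H\<^esub> f z = f (\<Phi> z) \<otimes>\<^bsub>H\<^esub> u" if "z \<in> carrier F" for z
  proof -
    have "u \<otimes>\<^bsub>H\<^esub> f z = u \<otimes>\<^bsub>H\<^esub> f z \<otimes>\<^bsub>H\<^esub> inv\<^bsub>H\<^esub> u \<otimes>\<^bsub>H\<^esub> u"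
      using u that by (simp add: H.m_assoc)
    then show ?thesis using rel[OF that] by simp
  qed
  have comm: "u [^]\<^bsub>H\<^esub> n \<otimes>\<^bsub>H\<^esub> f y = f (aut_pow F \<Phi> n y) \<otimes>\<^bsub>H\<^esub> u [^]\<^bsub>H\<^esub> n"
    if y: "y \<in> carrier F" for n :: int and y
  proof (induction n rule: int_induct[where k = 0])
    case base
    show ?case using y by simp
  next
    case (step1 i)
    let ?z = "aut_pow F \<Phi> i y"
    have z: "?z \<in> carrier F" using y by simp
    let ?U = "u [^]\<^bsub>H\<^esub> i"
    have p: "u [^]\<^bsub>H\<^esub> (i + 1) = u \<otimes>\<^bsub>H\<^esub> ?U"
      using u H.int_pow_mult[OF u, of 1 i] by (simp add: add.commute)
    have "u [^]\<^bsub>H\<^esub> (i + 1) \<otimes>\<^bsub>H\<^esub> f y = u \<otimes>\<^bsub>H\<^esub> (?U \<otimes>\<^bsub>H\<^esub> f y)"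
      using u y by (simp add: p H.m_assoc)
    also have "\<dots> = u \<otimes>\<^bsub>H\<^esub> f ?z \<otimes>\<^bsub>H\<^esub> ?U"
      using u z step1 by (simp add: H.m_assoc)
    also have "\<dots> = f (\<Phi> ?z) \<otimes>\<^bsub>H\<^esub> u [^]\<^bsub>H\<^esub> (i + 1)"
      using u z by (simp add: r[OF z] p H.m_assoc)
    finally show ?case by (simp add: aut_pow_Suc[OF y])
  next
    case (step2 i)
    let ?z = "aut_pow F \<Phi> (i - 1) y"
    have z: "?z \<in> carrier F" using y by simp
    have e: "aut_pow F \<Phi> i y = \<Phi> ?z" using aut_pow_Suc[OF y, of "i - 1"] by simp
    have p: "u [^]\<^bsub>H\<^esub> i = u \<otimes>\<^bsub>H\<^esub> u [^]\<^bsub>H\<^esub> (i - 1)"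
      using u H.int_pow_mult[OF u, of 1 "i - 1"] by simp
    have "u \<otimes>\<^bsub>H\<^esub> (u [^]\<^bsub>H\<^esub> (i - 1) \<otimes>\<^bsub>H\<^esub> f y) = u [^]\<^bsub>H\<^esub> i \<otimes>\<^bsub>H\<^esub> f y"
      using u y by (simp add: p H.m_assoc)
    also have "\<dots> = f (\<Phi> ?z) \<otimes>\<^bsub>H\<^esub> (u \<otimes>\<^bsub>H\<^esub> u [^]\<^bsub>H\<^esub> (i - 1))"
      using step2 e p by simp
    also have "\<dots> = u \<otimes>\<^bsub>H\<^esub> (f ?z \<otimes>\<^bsub>H\<^esub> u [^]\<^bsub>H\<^esub> (i - 1))"
      using u z r[OF z] by (simp add: H.m_assoc[symmetric])
    finally show ?case using u y z by simp
  qed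
  define g where "g = restrict (\<lambda>(x, n). f x \<otimes>\<^bsub>H\<^esub> u [^]\<^bsub>H\<^esub> (n::int)) (carrier F \<times> UNIV)"
  have "g \<in> hom (semidirect_int F \<Phi>) H"
  proof (rule homI)
    show "g p \<in> carrier H" if "p \<in> carrier (semidirect_int F \<Phi>)" for p
      using that u by (auto simp: g_def)
    show "g (p \<otimes>\<^bsub>semidirect_int F \<Phi>\<^esub> q) = g p \<otimes>\<^bsub>H\<^esub> g q"
      if pq: "p \<in> carrier (semidirect_int F \<Phi>)" "q \<in> carrier (semidirect_int F \<Phi>)" for p q
    proof -
      obtain x m y n where d: "p = (x, m)" "q = (y, n)" "x \<in> carrier F" "y \<in> carrier F"
        using pq by (cases p; cases q) auto
      have "g (p \<otimes>\<^bsub>semidirect_int F \<Phi>\<^esub> q) =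
          f x \<otimes>\<^bsub>H\<^esub> f (aut_pow F \<Phi> m y) \<otimes>\<^bsub>H\<^esub> (u [^]\<^bsub>H\<^esub> m \<otimes>\<^bsub>H\<^esub> u [^]\<^bsub>H\<^esub> n)"
        using d u by (simp add: g_def fm H.int_pow_mult)
      also have "\<dots> = f x \<otimes>\<^bsub>H\<^esub> (f (aut_pow F \<Phi> m y) \<otimes>\<^bsub>H\<^esub> u [^]\<^bsub>H\<^esub> m) \<otimes>\<^bsub>H\<^esub> u [^]\<^bsub>H\<^esub> n"
        using d u by (simp add: H.m_assoc)
      also have "\<dots> = f x \<otimes>\<^bsub>H\<^esub> (u [^]\<^bsub>H\<^esub> m \<otimes>\<^bsub>H\<^esub> f y) \<otimes>\<^bsub>H\<^esub> u [^]\<^bsub>H\<^esub> n"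
        using comm d by simp
      also have "\<dots> = g p \<otimes>\<^bsub>H\<^esub> g q"
        using d u by (simp add: g_def H.m_assoc)
      finally show ?thesis .
    qed
  qed
  moreover have "g \<in> extensional (carrier F \<times> UNIV)" by (simp add: g_def)
  moreover have "\<forall>x\<in>carrier F. g (x, 0) = f x" by (simp add: g_def)
  moreover have "g (\<one>\<^bsub>F\<^esub>, 1) = u" using u by (simp add: g_def f1)
  moreover have "g' = g"
    if g': "g' \<in> hom (semidirect_int F \<Phi>) H" "g' \<in> extensional (carrier F \<times> UNIV)"
      "\<forall>x\<in>carrier F. g' (x, 0) = f x" "g' (\<one>\<^bsub>F\<^esub>, 1) = u" for g'
  proof (rule extensionalityI[OF g'(2)])
    show "g \<in> extensional (carrier F \<times> UNIV)" by (simp add: g_def)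
    fix p :: "'a \<times> int" assume "p \<in> carrier F \<times> UNIV"
    then obtain x n where p: "p = (x, n)" "x \<in> carrier F" by (cases p) auto
    interpret g': group_hom "semidirect_int F \<Phi>" H g'
      by unfold_locales (rule g'(1))
    have one: "aut_pow F \<Phi> k \<one>\<^bsub>F\<^esub> = \<one>\<^bsub>F\<^esub>" for k
      using aut_pow_mult[of "\<one>\<^bsub>F\<^esub>" "\<one>\<^bsub>F\<^esub>" k]
        F.l_cancel_one'[of "aut_pow F \<Phi> k \<one>\<^bsub>F\<^esub>" "aut_pow F \<Phi> k \<one>\<^bsub>F\<^esub>"] by simp
    have t: "(\<one>\<^bsub>F\<^esub>, 1) [^]\<^bsub>semidirect_int F \<Phi>\<^esub> k = (\<one>\<^bsub>F\<^esub>, k)" for k :: int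
    proof (induction k rule: int_induct[where k = 0])
      case base
      show ?case by simp
    next
      case (step1 i)
      then show ?case
        using G.int_pow_mult[of "(\<one>\<^bsub>F\<^esub>, 1)" i 1] G.int_pow_1[of "(\<one>\<^bsub>F\<^esub>, 1)"] by (simp add: one)
    next
      case (step2 i)
      have "inv\<^bsub>semidirect_int F \<Phi>\<^esub> (\<one>\<^bsub>F\<^esub>, 1) = (\<one>\<^bsub>F\<^esub>, -1)"
        by (rule G.inv_equality) (simp_all add: one)
      then show ?case
        using G.int_pow_diff[of "(\<one>\<^bsub>F\<^esub>, 1)" i 1] G.int_pow_1[of "(\<one>\<^bsub>F\<^esub>, 1)"] step2 by (simp add: one)
    qed
    have "p = (x, 0) \<otimes>\<^bsub>semidirect_int F \<Phi>\<^esub> (\<one>\<^bsub>F\<^esub>, 1) [^]\<^bsub>semidirect_int F \<Phi>\<^esub> n"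
      using p by (simp add: t)
    then have "g' p = g' (x, 0) \<otimes>\<^bsub>H\<^esub> g' (\<one>\<^bsub>F\<^esub>, 1) [^]\<^bsub>H\<^esub> n"
      using g'.hom_mult[of "(x, 0)" "(\<one>\<^bsub>F\<^esub>, 1) [^]\<^bsub>semidirect_int F \<Phi>\<^esub> n"]
        g'.hom_int_pow[of "(\<one>\<^bsub>F\<^esub>, 1)" n] p by (simp add: t)
    then show "g' p = g p" using g' p by (simp add: g_def)
  qed
  ultimately show ?thesis by (intro ex1I[of _ g]) blast+
qed

end


section \<open>Graphs as metric spaces\<close>

text \<open>A graph is viewed as a one-dimensional complex: its points are the vertices and the interior
  points of the edges. \<open>Interior e s\<close> lies on the edge \<open>e\<close> at distance \<open>s\<close> from its tail. The
  orientation of an edge only serves to parametrise it, and paths may traverse it either way.\<close>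

datatype ('v, 'e) graph_point = Vertex 'v | Interior 'e real

definition points :: "('v, 'e) pre_digraph \<Rightarrow> ('v, 'e) graph_point set" where
  "points \<Gamma> = Vertex ` verts \<Gamma> \<union> {Interior e s | e s. e \<in> arcs \<Gamma> \<and> 0 < s \<and> s < 1}"

text \<open>The minimum is only meaningful if \<open>u\<close> and \<open>v\<close> are joined by an edge path, as is always the
  case in a connected graph.\<close>

definition vertex_dist :: "('v, 'e) pre_digraph \<Rightarrow> 'v \<Rightarrow> 'v \<Rightarrow> nat" where
  "vertex_dist \<Gamma> u v = (LEAST n. (u, v) \<in> (arcs_ends \<Gamma> \<union> (arcs_ends \<Gamma>)\<inverse>) ^^ n)"

text \<open>The vertices of the cell containing a point, with the distance to them inside that cell.\<close>

fun exits :: "('v, 'e) pre_digraph \<Rightarrow> ('v, 'e) graph_point \<Rightarrow> ('v \<times> real) set" where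
  "exits \<Gamma> (Vertex v) = {(v, 0)}"
| "exits \<Gamma> (Interior e s) = {(tail \<Gamma> e, s), (head \<Gamma> e, 1 - s)}"

text \<open>The lengths of the segment joining two points within a common open edge, if there is one.\<close>

fun direct_lengths :: "('v, 'e) graph_point \<Rightarrow> ('v, 'e) graph_point \<Rightarrow> real set" where
  "direct_lengths (Interior e s) (Interior e' s') = (if e = e' then {\<bar>s - s'\<bar>} else {})"
| "direct_lengths _ _ = {}"

text \<open>The combinatorial metric, i.e. the path metric in which every edge has length 1.\<close>

definition graph_dist ::
    "('v, 'e) pre_digraph \<Rightarrow> ('v, 'e) graph_point \<Rightarrow> ('v, 'e) graph_point \<Rightarrow> real" where
  "graph_dist \<Gamma> p q =
     Min (direct_lengths p q \<union>
          (\<lambda>((u, a), (v, b)). a + real (vertex_dist \<Gamma> u v) + b) ` (exits \<Gamma> p \<times> exits \<Gamma> q))"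

definition quasi_isometric_embedding ::
    "('v, 'e) pre_digraph \<Rightarrow> ('w, 'f) pre_digraph \<Rightarrow>
     (('v, 'e) graph_point \<Rightarrow> ('w, 'f) graph_point) \<Rightarrow> bool" where
  "quasi_isometric_embedding \<Gamma> \<Gamma>' f \<longleftrightarrow>
     f \<in> points \<Gamma> \<rightarrow> points \<Gamma>' \<and>
     (\<exists>K\<ge>1. \<forall>p\<in>points \<Gamma>. \<forall>q\<in>points \<Gamma>.
        1 / K * graph_dist \<Gamma> p q - K \<le> graph_dist \<Gamma>' (f p) (f q) \<and>
        graph_dist \<Gamma>' (f p) (f q) \<le> K * graph_dist \<Gamma> p q + K)"


section \<open>Cayley graphs and undistorted subgroups\<close>

definition cayley_graph :: "('a, 'b) monoid_scheme \<Rightarrow> 'a set \<Rightarrow> ('a, 'a \<times> 'a) pre_digraph" where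
  "cayley_graph G S =
     \<lparr>verts = carrier G, arcs = carrier G \<times> S, tail = fst, head = (\<lambda>(g, s). g \<otimes>\<^bsub>G\<^esub> s)\<rparr>"

definition undistorted :: "'a set \<Rightarrow> ('a, 'b) monoid_scheme \<Rightarrow> bool" where
  "undistorted H G \<longleftrightarrow>
     subgroup H G \<and> finitely_generated_group G \<and> finitely_generated_group (G\<lparr>carrier := H\<rparr>) \<and>
     (\<forall>S T. finite S \<and> S \<subseteq> H \<and> generate (G\<lparr>carrier := H\<rparr>) S = H \<and>
            finite T \<and> T \<subseteq> carrier G \<and> generate G T = carrier G \<longrightarrow>
        (\<exists>f. quasi_isometric_embedding (cayley_graph (G\<lparr>carrier := H\<rparr>) S) (cayley_graph G T) f \<and>
             (\<forall>h\<in>H. f (Vertex h) = Vertex h)))"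

lemma cayley_graph_connected:
  assumes "group G" and S: "S \<subseteq> carrier G" and gen: "generate G S = carrier G"
    and u: "u \<in> carrier G" and v: "v \<in> carrier G"
  shows "\<exists>n. (u, v) \<in> (arcs_ends (cayley_graph G S) \<union> (arcs_ends (cayley_graph G S))\<inverse>) ^^ n"
proof -
  interpret group G by fact
  let ?R = "arcs_ends (cayley_graph G S) \<union> (arcs_ends (cayley_graph G S))\<inverse>"
  have edge: "(g, g \<otimes>\<^bsub>G\<^esub> s) \<in> arcs_ends (cayley_graph G S)" if "g \<in> carrier G" "s \<in> S" for g s
    using that by (auto simp: arcs_ends_def arc_to_ends_def cayley_graph_def image_iff)
  have "(g, g \<otimes>\<^bsub>G\<^esub> h) \<in> ?R\<^sup>*" if "h \<in> generate G S" "g \<in> carrier G" for g h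
    using that
  proof (induction arbitrary: g rule: generate.induct)
    case one
    then show ?case by simp
  next
    case (incl h)
    then show ?case using edge by blast
  next
    case (inv h)
    then have "h \<in> carrier G" using S by blast
    then have "(g \<otimes>\<^bsub>G\<^esub> inv\<^bsub>G\<^esub> h, g) \<in> arcs_ends (cayley_graph G S)"
      using edge[of "g \<otimes>\<^bsub>G\<^esub> inv\<^bsub>G\<^esub> h" h] inv by (simp add: m_assoc)
    then show ?case by blast
  next
    case (eng h1 h2)
    then have c: "h1 \<in> carrier G" "h2 \<in> carrier G" using gen by auto
    have "(g, g \<otimes>\<^bsub>G\<^esub> h1) \<in> ?R\<^sup>*" "(g \<otimes>\<^bsub>G\<^esub> h1, g \<otimes>\<^bsub>G\<^esub> h1 \<otimes>\<^bsub>G\<^esub> h2) \<in> ?R\<^sup>*"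
      using eng c by auto
    then show ?case using c eng.prems by (simp add: m_assoc)
  qed
  from this[of "inv\<^bsub>G\<^esub> u \<otimes>\<^bsub>G\<^esub> v" u] have "(u, v) \<in> ?R\<^sup>*"
    using u v gen by (simp add: m_assoc[symmetric])
  then show ?thesis by (simp add: rtrancl_power)
qed

end

theory Submission
  imports Defs
begin

text \<open>Let \<open>x \<noteq> 1\<close> lie in the fibre \<open>F\<close>. The projection of the Cayley tree of \<open>F\<close> to the axis of \<open>x\<close>,
  measured in units of the translation length of \<open>x\<close>, is a Lipschitz function on \<open>F\<close> on which \<open>x\<close> acts as
  the translation by 1. Doing this in the fibre over every \<open>m\<close>, with \<open>\<Phi>\<^sup>-\<^sup>m x\<close> in place of \<open>x\<close>, and matching
  the origins of neighbouring fibres gives a Lipschitz function on all of \<open>F \<rtimes>\<^sub>\<Phi> \<int>\<close> on which \<open>x\<close> still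
  acts as the translation by 1, because the error made in passing between neighbouring fibres is
  bounded independently of \<open>m\<close>. Hence \<open>\<langle>x\<rangle>\<close> is undistorted. A slender subgroup \<open>H\<close> meets \<open>F\<close> in a cyclic
  group \<open>\<langle>x\<rangle>\<close> and has cyclic image in \<open>\<int>\<close>, so every element of \<open>H\<close> has the form \<open>x\<^sup>i h\<^sub>0\<^sup>q\<close>; the projection
  to \<open>\<int>\<close> controls \<open>q\<close>, and the Lipschitz function then controls \<open>i\<close>.\<close>

section \<open>Coboundaries of subsets of a group\<close>

text \<open>The obstacle is that \<Phi> may stretch words exponentially: the fibre itself may be
  badly distorted, and the elements \<Phi>^(-m) x need not have bounded length, so word length in
  the fibres cannot count powers of x. An axis function takes its unit from the element itself, and
  its nonnegative set is a halfspace cut off by a single edge of the tree. The coboundary of such a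
  set is bounded in terms of the multiplying element alone, whatever the axis; this is the source of
  every constant that is uniform in m. \<Phi> turns edges into paths, so an axis function composed
  with \<Phi> need not be one again. The comparison of neighbouring fibres is therefore asymmetric:
  one function contributes connected level sets, the other only small coboundaries. Cyclicity of the
  intersection with F is not read off from freeness of subgroups. Signed crossing numbers supply
  homomorphisms to the integers, and finite generation of the kernel of one of them forces that
  kernel to be trivial.\<close>

context group
begin

lemma mult_inv_cancel_left [simp]: "x \<in> carrier G \<Longrightarrow> y \<in> carrier G \<Longrightarrow> x \<otimes> (inv x \<otimes> y) = y"
  by (simp add: m_assoc[symmetric])

lemma inv_mult_cancel_left [simp]: "x \<in> carrier G \<Longrightarrow> y \<in> carrier G \<Longrightarrow> inv x \<otimes> (x \<otimes> y) = y"
  by (simp add: m_assoc[symmetric])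

lemma equivariant_int_pow:
  fixes \<psi> :: "'a \<Rightarrow> int"
  assumes y: "y \<in> carrier G" and eq: "\<And>g. g \<in> carrier G \<Longrightarrow> \<psi> (y \<otimes> g) = \<psi> g + 1"
    and g: "g \<in> carrier G"
  shows "\<psi> (y [^] (k::int) \<otimes> g) = \<psi> g + k"
proof (induction k rule: int_induct[where k = 0])
  case base
  show ?case using g by simp
next
  case (step1 i)
  have "y [^] (i + 1) = y \<otimes> y [^] i"
    using int_pow_mult[OF y, of 1 i] y by (simp add: add.commute)
  then show ?case using step1 eq[of "y [^] i \<otimes> g"] y g by (simp add: m_assoc)
next
  case (step2 i)
  have "y [^] i = y \<otimes> y [^] (i - 1)"
    using int_pow_mult[OF y, of 1 "i - 1"] y by simp
  then show ?case using step2 eq[of "y [^] (i - 1) \<otimes> g"] y g by (simp add: m_assoc)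
qed

text \<open>For a generator \<open>a\<close> these are the initial vertices of the
  \<open>a\<close>-edges of the Cayley graph with exactly one end in \<open>V\<close>. Other
  \<open>a\<close> are allowed because \<Phi> turns generators into words.\<close>

definition coboundary :: "'a set \<Rightarrow> 'a \<Rightarrow> 'a set" where
  "coboundary V a = {g \<in> carrier G. (g \<in> V) \<noteq> (g \<otimes> a \<in> V)}"

lemma coboundary_one [simp]: "coboundary V \<one> = {}"
  by (auto simp: coboundary_def)

text \<open>If \<open>g\<close> and \<open>g \<otimes> a \<otimes> b\<close> are separated by
  \<open>V\<close>, then one of the two steps through \<open>g \<otimes> a\<close> crosses the
  border. The second step starts at \<open>g \<otimes> a\<close>, whence the translation by
  \<open>inv a\<close>.\<close>

lemma coboundary_mult:
  assumes "a \<in> carrier G" "b \<in> carrier G"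
  shows "coboundary V (a \<otimes> b) \<subseteq> coboundary V a \<union> (\<lambda>g. g \<otimes> inv a) ` coboundary V b"
proof
  fix g assume g: "g \<in> coboundary V (a \<otimes> b)"
  then have gc: "g \<in> carrier G" by (simp add: coboundary_def)
  show "g \<in> coboundary V a \<union> (\<lambda>g. g \<otimes> inv a) ` coboundary V b"
  proof (cases "g \<in> coboundary V a")
    case False
    then have "g \<otimes> a \<in> coboundary V b"
      using g gc assms by (auto simp: coboundary_def m_assoc)
    moreover have "g = g \<otimes> a \<otimes> inv a" using gc assms by (simp add: m_assoc)
    ultimately show ?thesis by blast
  qed simp
qed

lemma card_coboundary_mult:
  assumes "a \<in> carrier G" "b \<in> carrier G"
    and "finite (coboundary V a)" "card (coboundary V a) \<le> m"
    and "finite (coboundary V b)" "card (coboundary V b) \<le> n"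
  shows "finite (coboundary V (a \<otimes> b)) \<and> card (coboundary V (a \<otimes> b)) \<le> m + n"
proof
  let ?R = "coboundary V a \<union> (\<lambda>g. g \<otimes> inv a) ` coboundary V b"
  have f: "finite ?R" using assms by simp
  then show "finite (coboundary V (a \<otimes> b))"
    using coboundary_mult[OF assms(1,2)] finite_subset by blast
  have "card (coboundary V (a \<otimes> b)) \<le> card ?R"
    using coboundary_mult[OF assms(1,2)] f by (rule card_mono[rotated])
  also have "\<dots> \<le> card (coboundary V a) + card ((\<lambda>g. g \<otimes> inv a) ` coboundary V b)"
    by (rule card_Un_le)
  also have "\<dots> \<le> m + n"
    using assms card_image_le[OF assms(5), of "\<lambda>g. g \<otimes> inv a"] by linarith
  finally show "card (coboundary V (a \<otimes> b)) \<le> m + n" .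
qed

text \<open>Each value strictly between \<open>\<psi> g\<close> and \<open>\<psi> (g a)\<close> gives a translate of \<open>{\<psi> \<ge> 0}\<close> separating
  \<open>g\<close> from \<open>g a\<close>.\<close>

lemma equivariant_diff_le:
  fixes \<psi> :: "'a \<Rightarrow> int"
  assumes y: "y \<in> carrier G" and eq: "\<And>g. g \<in> carrier G \<Longrightarrow> \<psi> (y \<otimes> g) = \<psi> g + 1"
    and a: "a \<in> carrier G"
    and fin: "finite (coboundary {g. 0 \<le> \<psi> g} a)"
    and card: "card (coboundary {g. 0 \<le> \<psi> g} a) \<le> N"
    and g: "g \<in> carrier G"
  shows "\<bar>\<psi> (g \<otimes> a) - \<psi> g\<bar> \<le> int N"
proof -
  define I where "I = {min (\<psi> g) (\<psi> (g \<otimes> a))<..max (\<psi> g) (\<psi> (g \<otimes> a))}"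
  let ?t = "\<lambda>k. y [^] (- k) \<otimes> g"
  have ps: "\<psi> (?t k) = \<psi> g - k" for k
    using equivariant_int_pow[where \<psi> = \<psi>, OF y eq g, of "- k"] by simp
  have ps2: "\<psi> (?t k \<otimes> a) = \<psi> (g \<otimes> a) - k" for k
    using equivariant_int_pow[where \<psi> = \<psi>, OF y eq, of "g \<otimes> a" "- k"] y a g by (simp add: m_assoc)
  have "?t ` I \<subseteq> coboundary {g. 0 \<le> \<psi> g} a"
    using y g ps ps2 by (auto simp: coboundary_def I_def min_def max_def)
  moreover have "inj_on ?t I"
    by (rule inj_onI) (metis ps add_diff_cancel_left' diff_diff_eq2 add.commute)
  ultimately have "card I \<le> N"
    using card_mono[OF fin] card_image card by (metis le_trans)
  then show ?thesis by (auto simp: I_def min_def max_def split: if_splits)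
qed

text \<open>If \<open>\<psi>'\<close> jumped much between two points of the connected level set \<open>{\<psi> = 0}\<close>, then many
  distinct translates of this level set would contain a coboundary edge of \<open>{\<psi>' \<ge> 0}\<close>.\<close>

lemma equivariant_compare:
  fixes \<psi> \<psi>' :: "'a \<Rightarrow> int"
  assumes y: "y \<in> carrier G" and eq: "\<And>g. g \<in> carrier G \<Longrightarrow> \<psi> (y \<otimes> g) = \<psi> g + 1"
    and eq': "\<And>g. g \<in> carrier G \<Longrightarrow> \<psi>' (y \<otimes> g) = \<psi>' g + 1"
    and X: "finite X" "X \<subseteq> carrier G"
    and fin: "\<And>x. x \<in> X \<Longrightarrow> finite (coboundary {g. 0 \<le> \<psi>' g} x)"
    and card: "\<And>x. x \<in> X \<Longrightarrow> card (coboundary {g. 0 \<le> \<psi>' g} x) \<le> N x"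
    and r: "r \<in> carrier G" "\<psi> r = 0"
    and conn: "\<And>V g. g \<in> carrier G \<Longrightarrow> \<psi> g = 0 \<Longrightarrow> (g \<in> V) \<noteq> (r \<in> V) \<Longrightarrow>
      \<exists>h\<in>carrier G. \<exists>x\<in>X. \<psi> h = 0 \<and> \<psi> (h \<otimes> x) = 0 \<and> (h \<in> V) \<noteq> (h \<otimes> x \<in> V)"
    and g: "g \<in> carrier G"
  shows "\<bar>\<psi>' g - \<psi> g - \<psi>' r\<bar> \<le> int (\<Sum>x\<in>X. N x)"
proof -
  have main: "\<bar>\<psi>' g - \<psi>' r\<bar> \<le> int (\<Sum>x\<in>X. N x)" if g: "g \<in> carrier G" "\<psi> g = 0" for g
  proof -
    define I where "I = {min (\<psi>' g) (\<psi>' r)<..max (\<psi>' g) (\<psi>' r)}"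
    define E where "E = (\<Union>x\<in>X. coboundary {g. 0 \<le> \<psi>' g} x)"
    have "\<exists>h\<in>E. \<psi> h = - k" if k: "k \<in> I" for k
    proof -
      have "(g \<in> {u. k \<le> \<psi>' u}) \<noteq> (r \<in> {u. k \<le> \<psi>' u})"
        using k by (auto simp: I_def)
      from conn[OF g this] obtain h x where hx: "h \<in> carrier G" "x \<in> X" "\<psi> h = 0"
        "(k \<le> \<psi>' h) \<noteq> (k \<le> \<psi>' (h \<otimes> x))" by auto
      have xc: "x \<in> carrier G" using X hx by auto
      \<comment> \<open>The translation moves the separating edge to the border of
        \<open>{\<psi>' \<ge> 0}\<close>, while its level \<open>- k\<close> under
        \<open>\<psi>\<close> still identifies \<open>k\<close>; this makes the choice of edges
        injective.\<close>
      let ?h = "y [^] (- k) \<otimes> h"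
      have "\<psi> ?h = - k" using equivariant_int_pow[where \<psi> = \<psi>, OF y eq hx(1), of "- k"] hx by simp
      moreover have "\<psi>' ?h = \<psi>' h - k"
        using equivariant_int_pow[where \<psi> = \<psi>', OF y eq' hx(1), of "- k"] by simp
      moreover have "\<psi>' (?h \<otimes> x) = \<psi>' (h \<otimes> x) - k"
        using equivariant_int_pow[where \<psi> = \<psi>', OF y eq', of "h \<otimes> x" "- k"] y xc hx by (simp add: m_assoc)
      ultimately have "?h \<in> coboundary {g. 0 \<le> \<psi>' g} x"
        using hx y by (auto simp: coboundary_def)
      then show ?thesis using hx \<open>\<psi> ?h = - k\<close> unfolding E_def by blast
    qed
    then obtain f where f: "\<And>k. k \<in> I \<Longrightarrow> f k \<in> E \<and> \<psi> (f k) = - k" by metis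
    have inj: "inj_on f I" by (rule inj_onI) (metis f neg_equal_iff_equal)
    have "finite E" using X fin by (auto simp: E_def)
    then have "card I \<le> card E"
      using card_mono[of E "f ` I"] f card_image[OF inj] by fastforce
    also have "\<dots> \<le> (\<Sum>x\<in>X. card (coboundary {g. 0 \<le> \<psi>' g} x))"
      unfolding E_def by (rule card_UN_le[OF X(1)])
    also have "\<dots> \<le> (\<Sum>x\<in>X. N x)" by (rule sum_mono) (rule card)
    finally have "int (card I) \<le> int (\<Sum>x\<in>X. N x)" by linarith
    then show ?thesis by (auto simp: I_def min_def max_def split: if_splits)
  qed
  \<comment> \<open>The difference of \<open>\<psi>'\<close> and \<open>\<psi>\<close> is invariant
    under \<open>y\<close>, so \<open>g\<close> may be moved to level 0.\<close>
  let ?g = "y [^] (- \<psi> g) \<otimes> g"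
  have "\<psi> ?g = 0" "\<psi>' ?g = \<psi>' g - \<psi> g"
    using equivariant_int_pow[where \<psi> = \<psi>, OF y eq g, of "- \<psi> g"] equivariant_int_pow[where \<psi> = \<psi>', OF y eq' g, of "- \<psi> g"]
    by simp_all
  then show ?thesis using main[of ?g] y g by (simp add: algebra_simps)
qed

end

section \<open>Reduced words and halfspaces\<close>

fun inv_letter :: "'a \<times> bool \<Rightarrow> 'a \<times> bool" where
  "inv_letter (x, b) = (x, \<not> b)"

lemma inv_letter_inv_letter [simp]: "inv_letter (inv_letter l) = l"
  by (cases l) simp

lemma cancelling_iff: "cancelling l m \<longleftrightarrow> m = inv_letter l"
  by (cases l; cases m) auto

definition is_reduced :: "('a \<times> bool) list \<Rightarrow> bool" where
  "is_reduced w \<longleftrightarrow> successively (\<lambda>l m. m \<noteq> inv_letter l) w"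

lemma reduced_words_iff:
  "w \<in> reduced_words X \<longleftrightarrow> set w \<subseteq> X \<times> UNIV \<and> is_reduced w"
  by (auto simp: reduced_words_def is_reduced_def successively_conv_nth cancelling_iff)

lemma is_reduced_append:
  "is_reduced (v @ w) \<longleftrightarrow>
     is_reduced v \<and> is_reduced w \<and> (v = [] \<or> w = [] \<or> hd w \<noteq> inv_letter (last v))"
  by (auto simp: is_reduced_def successively_append_iff)

lemma is_reduced_Nil [simp]: "is_reduced []" and is_reduced_single [simp]: "is_reduced [l]"
  by (simp_all add: is_reduced_def)

locale free_group_basis = group F for F (structure) +
  fixes X
  assumes basis: "free_basis F X"
begin

abbreviation val where "val \<equiv> word_value F"
abbreviation letters :: "('a \<times> bool) set" where "letters \<equiv> X \<times> UNIV"
abbreviation lval where "lval \<equiv> letter_value F"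

lemma basis_subset: "X \<subseteq> carrier F"
  using basis by (simp add: free_basis_def)

lemma lval_closed [simp]: "l \<in> letters \<Longrightarrow> lval l \<in> carrier F"
  using basis_subset by (auto simp: letter_value_def)

lemma lval_inv_letter: "l \<in> letters \<Longrightarrow> lval (inv_letter l) = inv (lval l)"
  using basis_subset by (cases l) (auto simp: letter_value_def)

lemma inv_letter_letters [simp]: "inv_letter l \<in> letters \<longleftrightarrow> l \<in> letters"
  by (cases l) simp

lemma val_Nil [simp]: "val [] = \<one>"
  by (simp add: word_value_def)

lemma val_Cons [simp]: "val (l # w) = lval l \<otimes> val w"
  by (simp add: word_value_def)

lemma val_closed [simp]: "set w \<subseteq> letters \<Longrightarrow> val w \<in> carrier F"
  by (induction w) auto

lemma val_append: "set v \<subseteq> letters \<Longrightarrow> set w \<subseteq> letters \<Longrightarrow> val (v @ w) = val v \<otimes> val w"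
  by (induction v) (auto simp: m_assoc)

definition nf :: "'a \<Rightarrow> ('a \<times> bool) list" where
  "nf g = inv_into (reduced_words X) val g"

lemma
  assumes "g \<in> carrier F"
  shows nf_letters: "set (nf g) \<subseteq> letters" and nf_reduced: "is_reduced (nf g)"
    and val_nf [simp]: "val (nf g) = g"
proof -
  have im: "val ` reduced_words X = carrier F"
    using basis by (simp add: free_basis_def bij_betw_def)
  have "nf g \<in> reduced_words X" using assms im unfolding nf_def by (metis inv_into_into)
  then show "set (nf g) \<subseteq> letters" "is_reduced (nf g)" by (simp_all add: reduced_words_iff)
  show "val (nf g) = g" using assms im unfolding nf_def by (metis f_inv_into_f)
qed

lemma nf_val [simp]: "set w \<subseteq> letters \<Longrightarrow> is_reduced w \<Longrightarrow> nf (val w) = w"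
  using basis unfolding nf_def free_basis_def bij_betw_def
  by (simp add: reduced_words_iff inv_into_f_f)

lemma nf_one [simp]: "nf \<one> = []"
  using nf_val[of "[]"] by simp

lemma nf_lval [simp]: "l \<in> letters \<Longrightarrow> nf (lval l) = [l]"
  using nf_val[of "[l]"] by simp

lemma nf_eq_Nil: "g \<in> carrier F \<Longrightarrow> nf g = [] \<longleftrightarrow> g = \<one>"
  by (metis nf_one val_Nil val_nf)

text \<open>The word on the right is reduced and has the right value, and reduced words are unique.
  In the Cayley tree a letter thus leads one step away from the identity or one step back.\<close>

lemma nf_mult_letter:
  assumes g: "g \<in> carrier F" and l: "l \<in> letters"
  shows "nf (g \<otimes> lval l) =
    (if nf g \<noteq> [] \<and> last (nf g) = inv_letter l then butlast (nf g) else nf g @ [l])"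
proof (cases "nf g \<noteq> [] \<and> last (nf g) = inv_letter l")
  case True
  then obtain v where v: "nf g = v @ [inv_letter l]" by (metis append_butlast_last_id)
  have vl: "set v \<subseteq> letters" "is_reduced v"
    using nf_letters[OF g] nf_reduced[OF g] v by (auto simp: is_reduced_append)
  have "g = val v \<otimes> inv (lval l)"
    using val_nf[OF g] v vl l val_append[of v "[inv_letter l]"] by (simp add: lval_inv_letter)
  then have "g \<otimes> lval l = val v" using vl l by (simp add: m_assoc)
  then show ?thesis using v vl by simp
next
  case False
  have "nf g = [] \<or> l \<noteq> inv_letter (last (nf g))" using False by auto
  then have "is_reduced (nf g @ [l])"
    using nf_reduced[OF g] by (auto simp: is_reduced_append)
  moreover have "val (nf g @ [l]) = g \<otimes> lval l"
    using val_append[OF nf_letters[OF g], of "[l]"] g l by simp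
  ultimately show ?thesis
    using False nf_val[of "nf g @ [l]"] nf_letters[OF g] l by auto
qed

text \<open>Inverting, concatenating and reducing words introduces no new basis elements, so those
  occurring in the normal forms of a finite generating set suffice for all normal forms. A basis
  element is its own normal form and must be among them.\<close>

lemma finite_basis:
  assumes "finitely_generated_group F"
  shows "finite X"
proof -
  obtain S where S: "finite S" "S \<subseteq> carrier F" "generate F S = carrier F"
    using assms by (auto simp: finitely_generated_group_def)
  define Y where "Y = (\<Union>s\<in>S. fst ` set (nf s))"
  have YX: "Y \<subseteq> X"
  proof
    fix x assume "x \<in> Y"
    then obtain t l where "t \<in> S" "l \<in> set (nf t)" "x = fst l" by (auto simp: Y_def)
    then show "x \<in> X" using S nf_letters[of t] by (cases l) auto
  qed
  have nfY: "set (nf h) \<subseteq> Y \<times> UNIV" if "h \<in> S" for h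
  proof
    fix l assume "l \<in> set (nf h)"
    then have "fst l \<in> Y" using that by (auto simp: Y_def)
    then show "l \<in> Y \<times> UNIV" by (cases l) simp
  qed
  have gen: "set (nf g) \<subseteq> Y \<times> UNIV" if "g \<in> generate F S" for g
  proof -
    have w: "\<exists>w. set w \<subseteq> Y \<times> UNIV \<and> val w = g" if "g \<in> generate F S" for g
      using that
    proof (induction rule: generate.induct)
      case one
      show ?case by (rule exI[of _ "[]"]) simp
    next
      case (incl h)
      then show ?case using nfY S val_nf[of h] by blast
    next
      case (inv h)
      then have hc: "h \<in> carrier F" using S by auto
      have "\<exists>v. set v \<subseteq> Y \<times> UNIV \<and> val v = inv (val w)" if "set w \<subseteq> Y \<times> UNIV" for w
        using that
      proof (induction w)
        case Nil
        show ?case by (rule exI[of _ "[]"]) simp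
      next
        case (Cons l w)
        then obtain v where v: "set v \<subseteq> Y \<times> UNIV" "val v = inv (val w)" by auto
        have sub: "set v \<subseteq> letters" "set w \<subseteq> letters" "l \<in> letters"
          using v Cons.prems YX by auto
        have "val (v @ [inv_letter l]) = inv (val (l # w))"
          using sub v val_append[of v "[inv_letter l]"]
          by (simp add: lval_inv_letter inv_mult_group)
        moreover have "set (v @ [inv_letter l]) \<subseteq> Y \<times> UNIV"
          using v Cons.prems by (cases l) auto
        ultimately show ?case by blast
      qed
      from this[OF nfY[OF inv]] show ?case using val_nf[OF hc] by simp
    next
      case (eng h1 h2)
      then obtain w1 w2 where w: "set w1 \<subseteq> Y \<times> UNIV" "val w1 = h1" "set w2 \<subseteq> Y \<times> UNIV" "val w2 = h2"
        by auto
      then have "val (w1 @ w2) = h1 \<otimes> h2" using val_append[of w1 w2] YX by blast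
      then show ?case using w by (intro exI[of _ "w1 @ w2"]) auto
    qed
    have "set (nf (val w)) \<subseteq> Y \<times> UNIV" if "set w \<subseteq> Y \<times> UNIV" for w
      using that
    proof (induction w rule: rev_induct)
      case Nil
      show ?case by simp
    next
      case (snoc l w)
      then have "set w \<subseteq> letters" "l \<in> letters" using YX by auto
      then have "nf (val (w @ [l])) = nf (val w) @ [l] \<or> nf (val (w @ [l])) = butlast (nf (val w))"
        using nf_mult_letter[of "val w" l] val_append[of w "[l]"] by auto
      moreover have "set (nf (val w)) \<subseteq> Y \<times> UNIV" "l \<in> Y \<times> UNIV" using snoc by auto
      moreover have "set (butlast v) \<subseteq> set v" for v :: "('a \<times> bool) list"
        by (auto dest: in_set_butlastD)
      ultimately show ?case by fastforce
    qed
    then show ?thesis using w[OF that] by blast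
  qed
  have "x \<in> Y" if "x \<in> X" for x
  proof -
    have "x = lval (x, True)" by (simp add: letter_value_def)
    then have "nf x = [(x, True)]" using nf_lval[of "(x, True)"] that by simp
    then show ?thesis using gen[of x] S basis_subset that by auto
  qed
  then have "X \<subseteq> Y" by auto
  moreover have "finite Y" using S by (simp add: Y_def)
  ultimately show ?thesis by (rule finite_subset)
qed

text \<open>The vertices of the Cayley tree on the far side of the edge from \<open>p\<close> to \<open>p s\<close>.\<close>

definition halfspace :: "'a \<Rightarrow> 'a \<times> bool \<Rightarrow> 'a set" where
  "halfspace p s = {g \<in> carrier F. nf (inv p \<otimes> g) \<noteq> [] \<and> hd (nf (inv p \<otimes> g)) = s}"

text \<open>A letter appended at the end can affect the first letter of a normal form only if the
  word is empty or is cancelled completely. These cases are the two directions of the edge between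
  \<open>p\<close> and \<open>p \<otimes> lval s\<close>.\<close>

lemma halfspace_edge:
  assumes p: "p \<in> carrier F" and s: "s \<in> letters" and g: "g \<in> carrier F" and l: "l \<in> letters"
    and sep: "(g \<in> halfspace p s) \<noteq> (g \<otimes> lval l \<in> halfspace p s)"
  shows "g = p \<and> l = s \<or> g = p \<otimes> lval s \<and> l = inv_letter s"
proof -
  let ?h = "inv p \<otimes> g"
  have h: "?h \<in> carrier F" using p g by simp
  have e: "nf (inv p \<otimes> (g \<otimes> lval l)) = nf (?h \<otimes> lval l)" using p g l by (simp add: m_assoc)
  define w where "w = nf ?h"
  have sep': "(w \<noteq> [] \<and> hd w = s) \<noteq> (nf (?h \<otimes> lval l) \<noteq> [] \<and> hd (nf (?h \<otimes> lval l)) = s)"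
    using sep p g l unfolding halfspace_def w_def e[symmetric] by simp
  have n: "nf (?h \<otimes> lval l) =
      (if w \<noteq> [] \<and> last w = inv_letter l then butlast w else w @ [l])"
    unfolding w_def by (rule nf_mult_letter[OF h l])
  have "w = [] \<and> l = s \<or> w = [s] \<and> l = inv_letter s"
  proof (cases w)
    case Nil
    then show ?thesis using sep' n by simp
  next
    case (Cons a v)
    have "v = []"
      using sep' n Cons by (cases "v = []") (simp_all split: if_splits)
    moreover have l: "a = inv_letter l"
      using sep' n Cons by (metis \<open>v = []\<close> append_Cons hd_append last.simps list.sel(1) list.distinct(1))
    ultimately have "nf (?h \<otimes> lval l) = []" using n Cons by simp
    then have "a = s" using sep' Cons by simp
    then show ?thesis using Cons \<open>v = []\<close> l inv_letter_inv_letter by metis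
  qed
  moreover have "g = p \<otimes> ?h" using p g by simp
  moreover have "?h = val w" unfolding w_def using val_nf[OF h] by simp
  ultimately show ?thesis using p s by (metis lval_closed r_one val_Cons val_Nil)
qed

lemma coboundary_halfspace_letter:
  assumes "p \<in> carrier F" "s \<in> letters" "l \<in> letters"
  shows "coboundary (halfspace p s) (lval l) \<subseteq> {p, p \<otimes> lval s}"
proof
  fix g assume "g \<in> coboundary (halfspace p s) (lval l)"
  then have "g \<in> carrier F" "(g \<in> halfspace p s) \<noteq> (g \<otimes> lval l \<in> halfspace p s)"
    by (simp_all add: coboundary_def)
  from halfspace_edge[OF assms(1,2) this(1) assms(3) this(2)] show "g \<in> {p, p \<otimes> lval s}"
    by (elim disjE conjE) simp_all
qed

text \<open>Each letter of \<open>a\<close> contributes at most 2, one for each end of the only edge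
  across the border.\<close>

lemma uniformly_finite_coboundary:
  assumes "a \<in> carrier F"
  obtains N where "\<And>p s. p \<in> carrier F \<Longrightarrow> s \<in> letters \<Longrightarrow>
    finite (coboundary (halfspace p s) a) \<and> card (coboundary (halfspace p s) a) \<le> N"
proof -
  have letter: "finite (coboundary (halfspace p s) (lval l)) \<and> card (coboundary (halfspace p s) (lval l)) \<le> 2"
    if "p \<in> carrier F" "s \<in> letters" "l \<in> letters" for p s l
  proof -
    have "card (coboundary (halfspace p s) (lval l)) \<le> card {p, p \<otimes> lval s}"
      by (rule card_mono) (use coboundary_halfspace_letter[OF that] in auto)
    also have "\<dots> \<le> 2" by (simp add: card_insert_if)
    finally show ?thesis
      using coboundary_halfspace_letter[OF that] finite_subset by blast
  qed
  have "\<exists>N. \<forall>p\<in>carrier F. \<forall>s\<in>letters.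
     finite (coboundary (halfspace p s) (val w)) \<and> card (coboundary (halfspace p s) (val w)) \<le> N"
    if "set w \<subseteq> letters" for w
    using that
  proof (induction w)
    case Nil
    show ?case by simp
  next
    case (Cons l w)
    then obtain N where "\<forall>p\<in>carrier F. \<forall>s\<in>letters.
       finite (coboundary (halfspace p s) (val w)) \<and> card (coboundary (halfspace p s) (val w)) \<le> N"
      by auto
    then have "finite (coboundary (halfspace p s) (val (l # w))) \<and>
        card (coboundary (halfspace p s) (val (l # w))) \<le> 2 + N"
      if "p \<in> carrier F" "s \<in> letters" for p s
      unfolding val_Cons
      using that Cons.prems letter[OF that, of l]
      by (intro card_coboundary_mult) auto
    then show ?case by blast
  qed
  from this[OF nf_letters[OF assms]] show ?thesis using assms that by auto
qed

end

section \<open>Minimal conjugates and axis functions in a free group\<close>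

lemma int_downset_bound:
  fixes S :: "int set"
  assumes "a \<in> S" "b \<notin> S" and down: "\<And>m n. n \<in> S \<Longrightarrow> m \<le> n \<Longrightarrow> m \<in> S"
  shows "\<exists>M. \<forall>n. n \<in> S \<longleftrightarrow> n \<le> M"
proof -
  have up: "n \<le> b" if "n \<in> S" for n
    using down[OF that, of b] assms(2) by linarith
  define k where "k = Max (S \<inter> {a..b})"
  have f: "finite (S \<inter> {a..b})" and ne: "S \<inter> {a..b} \<noteq> {}" using assms(1) up[of a] by auto
  have k: "k \<in> S" using Max_in[OF f ne] by (auto simp: k_def)
  have "n \<le> k" if "n \<in> S" for n
  proof (cases "a \<le> n")
    case True
    then show ?thesis using Max_ge[OF f, of n] that up by (simp add: k_def)
  next
    case False
    have "a \<le> k" unfolding k_def using assms(1) up[of a] by (intro Max_ge[OF f]) auto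
    then show ?thesis using False by simp
  qed
  then show ?thesis using k down by blast
qed

context free_group_basis
begin

text \<open>Minimising over \<open>N\<close> as well serves two purposes: for \<open>N = {y}\<close>
  it finds a point on the axis of \<open>y\<close>, for a subgroup \<open>N\<close> a shortest
  essential closed path in the quotient of the tree by \<open>N\<close>.\<close>

lemma ex_minimal_conjugate:
  assumes "n \<in> N" "n \<noteq> \<one>"
  shows "\<exists>p\<in>carrier F. \<exists>n\<in>N. n \<noteq> \<one> \<and>
    (\<forall>q\<in>carrier F. \<forall>m\<in>N. m \<noteq> \<one> \<longrightarrow>
       length (nf (inv p \<otimes> n \<otimes> p)) \<le> length (nf (inv q \<otimes> m \<otimes> q)))"
proof -
  let ?P = "\<lambda>(q, m). q \<in> carrier F \<and> m \<in> N \<and> m \<noteq> \<one>"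
  let ?l = "\<lambda>(q, m). length (nf (inv q \<otimes> m \<otimes> q))"
  have "?P (\<one>, n)" using assms by simp
  from ex_has_least_nat[of ?P, OF this, of ?l]
  obtain z where z: "?P z" "\<And>u. ?P u \<Longrightarrow> ?l z \<le> ?l u" by blast
  obtain p m where pm: "z = (p, m)" by fastforce
  have "length (nf (inv p \<otimes> m \<otimes> p)) \<le> length (nf (inv q \<otimes> m' \<otimes> q))"
    if "q \<in> carrier F" "m' \<in> N" "m' \<noteq> \<one>" for q m'
    using z(2)[of "(q, m')"] that pm by simp
  then show ?thesis using z(1) pm by auto
qed

text \<open>Otherwise the last edge of the path from \<open>p\<close> to
  \<open>y \<otimes> p\<close> is the \<open>y\<close>-translate of the first one traversed
  backwards, and moving \<open>p\<close> along that first edge shortens \<open>c\<close> by two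
  letters.\<close>

lemma minimal_conjugate:
  assumes p: "p \<in> carrier F" and y: "y \<in> carrier F" "y \<noteq> \<one>"
    and min: "\<And>q. q \<in> carrier F \<Longrightarrow>
      length (nf (inv p \<otimes> y \<otimes> p)) \<le> length (nf (inv q \<otimes> y \<otimes> q))"
    and c: "c = nf (inv p \<otimes> y \<otimes> p)"
  shows "c \<noteq> []" and "hd c \<noteq> inv_letter (last c)"
proof -
  have cc: "inv p \<otimes> y \<otimes> p \<in> carrier F" using p y by simp
  show ne: "c \<noteq> []"
  proof
    assume "c = []"
    then have "inv p \<otimes> y \<otimes> p = \<one>" using nf_eq_Nil[OF cc] c by simp
    then have "p \<otimes> (inv p \<otimes> y \<otimes> p) \<otimes> inv p = \<one>" using p by simp
    then show False using p y by (simp add: m_assoc)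
  qed
  show "hd c \<noteq> inv_letter (last c)"
  proof
    assume h: "hd c = inv_letter (last c)"
    obtain u l where u: "c = u @ [l]" using ne by (metis append_butlast_last_id)
    have "u \<noteq> []" using h u by (cases l) auto
    then obtain v where v: "u = inv_letter l # v" using h u by (cases u) auto
    have cl: "set c \<subseteq> letters" "is_reduced c" using nf_letters[OF cc] nf_reduced[OF cc] c by auto
    then have l: "l \<in> letters" and vl: "set v \<subseteq> letters" using u v by auto
    have vr: "is_reduced v"
      using cl is_reduced_append[of "[inv_letter l]" "v @ [l]"] is_reduced_append[of v "[l]"] u v by simp
    let ?q = "p \<otimes> lval (inv_letter l)"
    have q: "?q \<in> carrier F" using p l by simp
    have "inv p \<otimes> (y \<otimes> p) = val c"
      using val_nf[OF cc] p y unfolding c by (simp add: m_assoc)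
    also have "\<dots> = inv (lval l) \<otimes> (val v \<otimes> lval l)"
      using u v vl l val_append[of v "[l]"] by (simp add: lval_inv_letter)
    finally have e: "inv p \<otimes> (y \<otimes> p) = inv (lval l) \<otimes> (val v \<otimes> lval l)" .
    have "inv ?q \<otimes> y \<otimes> ?q = lval l \<otimes> (inv p \<otimes> (y \<otimes> p)) \<otimes> inv (lval l)"
      using p y l by (simp add: inv_mult_group lval_inv_letter m_assoc)
    also have "\<dots> = val v" unfolding e using vl l by (simp add: m_assoc)
    finally have "nf (inv ?q \<otimes> y \<otimes> ?q) = v" using vl vr by simp
    then have "length c \<le> length v" using min[OF q] c by simp
    then show False using u v by simp
  qed
qed

text \<open>An axis function for \<open>y\<close> records the projection of a vertex to the axis of \<open>y\<close> in the Cayley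
  tree, in units of the translation length of \<open>y\<close>; its level sets are connected.\<close>

definition axis_function :: "'a \<Rightarrow> ('a \<Rightarrow> int) \<Rightarrow> bool" where
  "axis_function y \<psi> \<longleftrightarrow>
     (\<forall>g\<in>carrier F. \<psi> (y \<otimes> g) = \<psi> g + 1) \<and>
     (\<exists>p\<in>carrier F. \<exists>s\<in>letters. \<forall>g\<in>carrier F. 0 \<le> \<psi> g \<longleftrightarrow> g \<in> halfspace p s) \<and>
     (\<exists>r\<in>carrier F. \<psi> r = 0 \<and>
       (\<forall>V. \<forall>g\<in>carrier F. \<psi> g = 0 \<longrightarrow> (g \<in> V) \<noteq> (r \<in> V) \<longrightarrow>
         (\<exists>h\<in>carrier F. \<exists>x\<in>X. \<psi> h = 0 \<and> \<psi> (h \<otimes> x) = 0 \<and> (h \<in> V) \<noteq> (h \<otimes> x \<in> V))))"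

text \<open>The first edge of the path from \<open>p\<close> to \<open>y \<otimes> p\<close> cuts
  off a halfspace \<open>U\<close>. Its translates y^n U decrease with n, and
  \<open>\<psi> g\<close> is the largest n such that y^n U contains \<open>g\<close>.\<close>

lemma ex_axis_function:
  assumes y: "y \<in> carrier F" "y \<noteq> \<one>"
  shows "\<exists>\<psi>. axis_function y \<psi>"
proof -
  obtain p where p: "p \<in> carrier F" and min: "\<And>q. q \<in> carrier F \<Longrightarrow>
      length (nf (inv p \<otimes> y \<otimes> p)) \<le> length (nf (inv q \<otimes> y \<otimes> q))"
    using ex_minimal_conjugate[of y "{y}"] y by auto
  define c where "c = nf (inv p \<otimes> y \<otimes> p)"
  define s where "s = hd c"
  have c: "c \<noteq> []" "s \<noteq> inv_letter (last c)"
    using minimal_conjugate[OF p y min c_def] by (simp_all add: s_def)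
  have cc: "inv p \<otimes> y \<otimes> p \<in> carrier F" using p y by simp
  have cl: "set c \<subseteq> letters" "is_reduced c" and vc: "val c = inv p \<otimes> y \<otimes> p"
    unfolding c_def by (rule nf_letters[OF cc] nf_reduced[OF cc] val_nf[OF cc])+
  have s: "s \<in> letters" using cl c by (auto simp: s_def)
  let ?U = "halfspace p s"
  \<comment> \<open>The vertex of \<open>U\<close> next to \<open>p\<close>. It does not lie in the
    translate of \<open>U\<close> by \<open>y\<close>, so it has level 0 and is the base point of
    that level set.\<close>
  define r where "r = p \<otimes> lval s"
  have r: "r \<in> carrier F" using p s by (simp add: r_def)
  have nfr: "nf (inv p \<otimes> r) = [s]" using p s by (simp add: r_def)
  have pU: "p \<notin> ?U" using p by (simp add: halfspace_def)
  have rU: "r \<in> ?U" using nfr r by (simp add: halfspace_def)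
  have UF: "g \<in> carrier F" if "g \<in> ?U" for g using that by (simp add: halfspace_def)
  \<comment> \<open>Cyclic reducedness enters here: nothing cancels where \<open>c\<close> meets a
    word starting with \<open>s\<close>. Hence \<open>y\<close> maps \<open>U\<close> into
    itself.\<close>
  have nfU: "nf (inv p \<otimes> (y \<otimes> g)) = c @ nf (inv p \<otimes> g)" if "g \<in> ?U" for g
  proof -
    have g: "g \<in> carrier F" using that UF by simp
    then have ig: "inv p \<otimes> g \<in> carrier F" using p by simp
    have "inv p \<otimes> (y \<otimes> g) = val c \<otimes> (inv p \<otimes> g)"
      unfolding vc using p y g by (simp add: m_assoc)
    also have "\<dots> = val (c @ nf (inv p \<otimes> g))"
      using val_append[OF cl(1) nf_letters[OF ig]] val_nf[OF ig] by simp
    finally have e: "inv p \<otimes> (y \<otimes> g) = val (c @ nf (inv p \<otimes> g))" .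
    have "is_reduced (c @ nf (inv p \<otimes> g))"
      unfolding is_reduced_append using that c cl nf_reduced[OF ig] by (simp add: halfspace_def)
    then show ?thesis unfolding e using cl nf_letters[OF ig] by simp
  qed
  have yU: "y \<otimes> g \<in> ?U" if "g \<in> ?U" for g
    using nfU[OF that] UF[OF that] y c unfolding halfspace_def s_def by simp
  have yp: "y \<otimes> p \<in> ?U"
    using p y c by (simp add: halfspace_def m_assoc[symmetric] c_def[symmetric] s_def[symmetric])
  have yr: "inv y \<otimes> r \<notin> ?U"
  proof
    assume a: "inv y \<otimes> r \<in> ?U"
    have "y \<otimes> (inv y \<otimes> r) = r" using y r by simp
    then have "[s] = c @ nf (inv p \<otimes> (inv y \<otimes> r))" using nfU[OF a] nfr by simp
    moreover have "nf (inv p \<otimes> (inv y \<otimes> r)) \<noteq> []" using a by (simp add: halfspace_def)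
    ultimately show False using c by (simp add: Cons_eq_append_conv)
  qed
  let ?t = "\<lambda>n g. y [^] (- n::int) \<otimes> g"
  have t0: "?t n g \<in> carrier F" if "g \<in> carrier F" for n g using that y by simp
  have tm: "?t n (g \<otimes> h) = ?t n g \<otimes> h" if "g \<in> carrier F" "h \<in> carrier F" for n g h
    using that y by (simp add: m_assoc)
  have t1: "?t (n - 1) g = y \<otimes> ?t n g" if "g \<in> carrier F" for n g
  proof -
    have "y [^] (- (n - 1)) = y \<otimes> y [^] (- n)"
      using int_pow_mult[OF y(1), of 1 "- n"] y by simp
    then show ?thesis using that y by (simp add: m_assoc)
  qed
  have t2: "?t (n + 1) g = inv y \<otimes> ?t n g" if "g \<in> carrier F" for n g
    using t1[OF that, of "n + 1"] that y by simp
  have word: "g = p \<otimes> val (nf (inv p \<otimes> g))" if "g \<in> carrier F" for g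
    using that p by simp
  \<comment> \<open>Induction along the path from \<open>p\<close>: the only way to leave y^n U is
    to step onto y^n p, and this vertex lies in y^(n-1) U.\<close>
  have ex_in: "\<exists>n. ?t n (p \<otimes> val w) \<in> ?U" if "set w \<subseteq> letters" for w
    using that
  proof (induction w rule: rev_induct)
    case Nil
    have "?t (- 1) (p \<otimes> val []) \<in> ?U" using yp y p by simp
    then show ?case by blast
  next
    case (snoc l w)
    then obtain n where n: "?t n (p \<otimes> val w) \<in> ?U" by auto
    have wl: "val w \<in> carrier F" "l \<in> letters" using snoc by auto
    have e: "p \<otimes> val (w @ [l]) = p \<otimes> val w \<otimes> lval l"
      using snoc p wl by (simp add: val_append m_assoc)
    have e2: "?t n (p \<otimes> val (w @ [l])) = ?t n (p \<otimes> val w) \<otimes> lval l"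
      unfolding e using tm[of "p \<otimes> val w" "lval l"] p wl by simp
    show ?case
    proof (cases "?t n (p \<otimes> val w) \<otimes> lval l \<in> ?U")
      case True
      then show ?thesis using e2 by metis
    next
      case False
      have "?t n (p \<otimes> val w) \<noteq> p" using n pU by metis
      then have "?t n (p \<otimes> val w) = p \<otimes> lval s" "l = inv_letter s"
        using halfspace_edge[OF p s UF[OF n] wl(2)] n False by metis+
      then have "?t n (p \<otimes> val (w @ [l])) = p"
        unfolding e2 using p s by (simp add: lval_inv_letter m_assoc)
      then have "?t (n - 1) (p \<otimes> val (w @ [l])) \<in> ?U"
        using t1[of "p \<otimes> val (w @ [l])" n] p snoc.prems yp by simp
      then show ?thesis by blast
    qed
  qed
  \<comment> \<open>Dually, the only way to enter y^n U is to step onto y^n r, and this vertex lies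
    outside y^(n+1) U.\<close>
  have ex_out: "\<exists>n. ?t n (p \<otimes> val w) \<notin> ?U" if "set w \<subseteq> letters" for w
    using that
  proof (induction w rule: rev_induct)
    case Nil
    have "?t 0 (p \<otimes> val []) \<notin> ?U" using pU p by simp
    then show ?case by blast
  next
    case (snoc l w)
    then obtain n where n: "?t n (p \<otimes> val w) \<notin> ?U" by auto
    have wl: "val w \<in> carrier F" "l \<in> letters" using snoc by auto
    have e: "p \<otimes> val (w @ [l]) = p \<otimes> val w \<otimes> lval l"
      using snoc p wl by (simp add: val_append m_assoc)
    have e2: "?t n (p \<otimes> val (w @ [l])) = ?t n (p \<otimes> val w) \<otimes> lval l"
      unfolding e using tm[of "p \<otimes> val w" "lval l"] p wl by simp
    have tc: "?t n (p \<otimes> val w) \<in> carrier F" using t0 p wl by simp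
    show ?case
    proof (cases "?t n (p \<otimes> val w) \<otimes> lval l \<in> ?U")
      case False
      then show ?thesis using e2 by metis
    next
      case True
      have "?t n (p \<otimes> val w) \<noteq> p \<otimes> lval s" using n rU r_def by metis
      then have "?t n (p \<otimes> val w) = p" "l = s"
        using halfspace_edge[OF p s tc wl(2)] n True by metis+
      then have "?t n (p \<otimes> val (w @ [l])) = r"
        unfolding e2 r_def by simp
      then have "?t (n + 1) (p \<otimes> val (w @ [l])) \<notin> ?U"
        using t2[of "p \<otimes> val (w @ [l])" n] p snoc.prems yr by simp
      then show ?thesis by blast
    qed
  qed
  have down: "?t m g \<in> ?U" if "?t n g \<in> ?U" "m \<le> n" "g \<in> carrier F" for m n g
    using that(2,1)
  proof (induction m rule: int_le_induct)
    case base
    then show ?case .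
  next
    case (step i)
    then show ?case using t1[OF that(3), of i] yU by simp
  qed
  have "\<exists>M. \<forall>n. ?t n g \<in> ?U \<longleftrightarrow> n \<le> M" if g: "g \<in> carrier F" for g
  proof -
    have l: "set (nf (inv p \<otimes> g)) \<subseteq> letters" using nf_letters g p by simp
    obtain a b where "?t a g \<in> ?U" "?t b g \<notin> ?U"
      using ex_in[OF l] ex_out[OF l] word[OF g] by metis
    then have "\<exists>M. \<forall>n. n \<in> {n. ?t n g \<in> ?U} \<longleftrightarrow> n \<le> M"
      using down[OF _ _ g] by (intro int_downset_bound[of a _ b]) auto
    then show ?thesis by simp
  qed
  then obtain \<psi> where \<psi>: "\<And>g n. g \<in> carrier F \<Longrightarrow> n \<le> \<psi> g \<longleftrightarrow> ?t n g \<in> ?U" by metis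
  have \<psi>0: "0 \<le> \<psi> g \<longleftrightarrow> g \<in> ?U" if "g \<in> carrier F" for g
    using \<psi>[OF that, of 0] that by simp
  have \<psi>1: "1 \<le> \<psi> g \<longleftrightarrow> inv y \<otimes> g \<in> ?U" if "g \<in> carrier F" for g
    using \<psi>[OF that, of 1] that y by (simp add: int_pow_neg)
  have \<psi>y: "\<psi> (y \<otimes> g) = \<psi> g + 1" if g: "g \<in> carrier F" for g
  proof -
    have "n \<le> \<psi> (y \<otimes> g) \<longleftrightarrow> n \<le> \<psi> g + 1" for n
    proof -
      have "y [^] (- n) \<otimes> y = y [^] (- (n - 1))"
        using int_pow_mult[OF y(1), of "- n" 1] y by simp
      then have "?t n (y \<otimes> g) = ?t (n - 1) g"
        using g y by (simp add: m_assoc[symmetric])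
      then have "n \<le> \<psi> (y \<otimes> g) \<longleftrightarrow> n - 1 \<le> \<psi> g"
        using \<psi>[of "y \<otimes> g" n] \<psi>[OF g, of "n - 1"] g y by simp
      then show ?thesis by linarith
    qed
    then show ?thesis by (metis order_antisym order_refl)
  qed
  have \<psi>r: "\<psi> r = 0" using \<psi>0[OF r] \<psi>1[OF r] rU yr by linarith
  \<comment> \<open>The reduced path from \<open>r\<close> to a vertex of level 0 stays at level 0.
    It stays in \<open>U\<close> because its word starts with \<open>s\<close>; had it entered the
    translate of \<open>U\<close> by \<open>y\<close>, it could leave again only by backtracking
    over the edge between \<open>y \<otimes> r\<close> and \<open>y \<otimes> p\<close>. So some
    edge of the path separates as required.\<close>
  have conn: "\<exists>h\<in>carrier F. \<exists>x\<in>X. \<psi> h = 0 \<and> \<psi> (h \<otimes> x) = 0 \<and> (h \<in> V) \<noteq> (h \<otimes> x \<in> V)"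
    if "set w \<subseteq> letters" "is_reduced w" "w \<noteq> []" "hd w = s" "\<psi> (p \<otimes> val w) = 0"
      "(p \<otimes> val w \<in> V) \<noteq> (r \<in> V)" for w V
    using that
  proof (induction w rule: rev_induct)
    case Nil
    then show ?case by simp
  next
    case (snoc l w)
    let ?g = "p \<otimes> val (w @ [l])" and ?g' = "p \<otimes> val w"
    have wl: "set w \<subseteq> letters" "l \<in> letters" "is_reduced w"
      using snoc.prems by (simp_all add: is_reduced_append)
    have g: "?g \<in> carrier F" "?g' \<in> carrier F" using p snoc.prems(1) by simp_all
    have e: "?g = ?g' \<otimes> lval l" using wl p by (simp add: val_append m_assoc)
    have "w \<noteq> []"
    proof
      assume "w = []"
      then have "?g = r" using snoc.prems(4) s by (simp add: r_def)
      then show False using snoc.prems(6) by simp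
    qed
    then have hw: "hd w = s" using snoc.prems(4) by simp
    have nfw: "nf (inv p \<otimes> ?g') = w" using p wl by simp
    then have "?g' \<in> ?U" using hw \<open>w \<noteq> []\<close> g by (simp add: halfspace_def)
    moreover have "\<not> 1 \<le> \<psi> ?g'"
    proof
      assume "1 \<le> \<psi> ?g'"
      then have a: "inv y \<otimes> ?g' \<in> ?U" using \<psi>1 g by simp
      have "inv y \<otimes> ?g \<notin> ?U" using \<psi>1[OF g(1)] snoc.prems(5) by simp
      then have b: "inv y \<otimes> ?g' \<otimes> lval l \<notin> ?U"
        unfolding e using y g(2) wl(2) by (simp add: m_assoc)
      have "inv y \<otimes> ?g' \<noteq> p" using a pU by metis
      then have h: "inv y \<otimes> ?g' = r" "l = inv_letter s"
        using halfspace_edge[OF p s UF[OF a] wl(2)] a b r_def by metis+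
      have "nf (inv p \<otimes> (y \<otimes> (inv y \<otimes> ?g'))) = c @ [s]"
        using nfU[OF a] h nfr by simp
      then have "w = c @ [s]" using nfw y g(2) by simp
      then have "last w = s" by simp
      then show False using snoc.prems(2) \<open>w \<noteq> []\<close> h(2) by (simp add: is_reduced_append)
    qed
    ultimately have g'0: "\<psi> ?g' = 0" using \<psi>0[OF g(2)] by linarith
    show ?case
    proof (cases "(?g' \<in> V) \<noteq> (r \<in> V)")
      case True
      then show ?thesis using snoc.IH[OF wl(1,3) \<open>w \<noteq> []\<close> hw g'0] by simp
    next
      case False
      then have sep: "(?g' \<in> V) \<noteq> (?g \<in> V)" using snoc.prems(6) by simp
      obtain x b where l: "l = (x, b)" "x \<in> X" using wl by (cases l) auto
      have xc: "x \<in> carrier F" using l basis_subset by auto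
      show ?thesis
      proof (cases b)
        case True
        then have "?g = ?g' \<otimes> x" using e l by (simp add: letter_value_def)
        then show ?thesis using g sep g'0 snoc.prems(5) l by metis
      next
        case False
        then have "?g \<otimes> x = ?g'" using e l xc g by (simp add: letter_value_def m_assoc)
        then show ?thesis using g sep g'0 snoc.prems(5) l by metis
      qed
    qed
  qed
  have conn': "\<exists>h\<in>carrier F. \<exists>x\<in>X. \<psi> h = 0 \<and> \<psi> (h \<otimes> x) = 0 \<and> (h \<in> V) \<noteq> (h \<otimes> x \<in> V)"
    if "g \<in> carrier F" "\<psi> g = 0" "(g \<in> V) \<noteq> (r \<in> V)" for V g
  proof -
    have "g \<in> ?U" using \<psi>0[OF that(1)] that(2) by simp
    then have "nf (inv p \<otimes> g) \<noteq> []" "hd (nf (inv p \<otimes> g)) = s" by (simp_all add: halfspace_def)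
    moreover have "set (nf (inv p \<otimes> g)) \<subseteq> letters" "is_reduced (nf (inv p \<otimes> g))"
      using nf_letters nf_reduced that p by simp_all
    ultimately show ?thesis using conn[of "nf (inv p \<otimes> g)" V] word[OF that(1)] that by simp
  qed
  have U': "\<exists>p\<in>carrier F. \<exists>s\<in>letters. \<forall>g\<in>carrier F. 0 \<le> \<psi> g \<longleftrightarrow> g \<in> halfspace p s"
    by (intro bexI[OF _ p] bexI[OF _ s] ballI \<psi>0)
  have "axis_function y \<psi>"
    unfolding axis_function_def
    by (intro conjI bexI[OF _ r] ballI allI impI \<psi>y \<psi>r conn' U')
  then show ?thesis by blast
qed

end

section \<open>Equivariant Lipschitz functions on the extension, assembled from the fibres\<close>

lemma ex_int_antidifference:
  fixes \<beta> :: "int \<Rightarrow> int"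
  shows "\<exists>b. \<forall>m. b (m + 1) = b m + \<beta> m"
proof -
  define b where "b m = (if 0 \<le> m then \<Sum>i\<in>{0..<m}. \<beta> i else - (\<Sum>i\<in>{m..<0}. \<beta> i))" for m
  have "b (m + 1) = b m + \<beta> m" for m
  proof (cases "0 \<le> m")
    case True
    have "{0..<m + 1} = insert m {0..<m}" using True by auto
    then show ?thesis using True by (simp add: b_def)
  next
    case False
    have "{m..<0} = insert m {m + 1..<0}" using False by auto
    then show ?thesis using False by (cases "m = - 1") (auto simp: b_def)
  qed
  then show ?thesis by blast
qed

context free_group_basis
begin

lemma coboundary_cong:
  assumes "a \<in> carrier F" and "\<And>g. g \<in> carrier F \<Longrightarrow> g \<in> V \<longleftrightarrow> g \<in> W"
  shows "coboundary V a = coboundary W a"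
  unfolding coboundary_def by (intro Collect_cong conj_cong refl) (simp add: assms)

text \<open>The order of quantifiers is the point: \<open>N\<close> is chosen before
  \<open>y\<close> and \<open>\<psi>\<close>, so it serves the axis functions of all fibres at once,
  however long their elements are.\<close>

lemma uniformly_finite_axis_coboundary:
  assumes a: "a \<in> carrier F"
  shows "\<exists>N. \<forall>y \<psi>. axis_function y \<psi> \<longrightarrow>
    finite (coboundary {g. 0 \<le> \<psi> g} a) \<and> card (coboundary {g. 0 \<le> \<psi> g} a) \<le> N"
proof -
  obtain N where N: "\<And>p s. p \<in> carrier F \<Longrightarrow> s \<in> letters \<Longrightarrow>
    finite (coboundary (halfspace p s) a) \<and> card (coboundary (halfspace p s) a) \<le> N"
    using uniformly_finite_coboundary[OF a] by blast
  have "finite (coboundary {g. 0 \<le> \<psi> g} a) \<and> card (coboundary {g. 0 \<le> \<psi> g} a) \<le> N"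
    if "axis_function y \<psi>" for y \<psi>
  proof -
    have "\<exists>p\<in>carrier F. \<exists>s\<in>letters. \<forall>g\<in>carrier F. 0 \<le> \<psi> g \<longleftrightarrow> g \<in> halfspace p s"
      using that unfolding axis_function_def by (elim conjE)
    then obtain p s where ps: "p \<in> carrier F" "s \<in> letters"
      "\<forall>g\<in>carrier F. 0 \<le> \<psi> g \<longleftrightarrow> g \<in> halfspace p s"
      by (elim bexE)
    have "coboundary {g. 0 \<le> \<psi> g} a = coboundary (halfspace p s) a"
      by (rule coboundary_cong[OF a]) (simp add: ps(3))
    then show ?thesis using N[OF ps(1,2)] by simp
  qed
  then show ?thesis by blast
qed

text \<open>Nothing is asked of the level sets of \<open>\<psi>'\<close>, which will be an axis
  function composed with \<Phi>.\<close>

lemma axis_function_compare: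
  assumes \<psi>: "axis_function y \<psi>" and y: "y \<in> carrier F" and X: "finite X"
    and eq': "\<And>g. g \<in> carrier F \<Longrightarrow> \<psi>' (y \<otimes> g) = \<psi>' g + 1"
    and fin: "\<And>x. x \<in> X \<Longrightarrow> finite (coboundary {g. 0 \<le> \<psi>' g} x) \<and>
      card (coboundary {g. 0 \<le> \<psi>' g} x) \<le> N x"
  shows "\<exists>b. \<forall>g\<in>carrier F. \<bar>\<psi>' g - \<psi> g - b\<bar> \<le> int (\<Sum>x\<in>X. N x)"
proof -
  have "\<exists>r\<in>carrier F. \<psi> r = 0 \<and>
       (\<forall>V. \<forall>g\<in>carrier F. \<psi> g = 0 \<longrightarrow> (g \<in> V) \<noteq> (r \<in> V) \<longrightarrow>
         (\<exists>h\<in>carrier F. \<exists>x\<in>X. \<psi> h = 0 \<and> \<psi> (h \<otimes> x) = 0 \<and> (h \<in> V) \<noteq> (h \<otimes> x \<in> V)))"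
    using \<psi> unfolding axis_function_def by (elim conjE)
  then obtain r where r: "r \<in> carrier F" "\<psi> r = 0"
    and conn: "\<And>V g. g \<in> carrier F \<Longrightarrow> \<psi> g = 0 \<Longrightarrow> (g \<in> V) \<noteq> (r \<in> V) \<Longrightarrow>
       \<exists>h\<in>carrier F. \<exists>x\<in>X. \<psi> h = 0 \<and> \<psi> (h \<otimes> x) = 0 \<and> (h \<in> V) \<noteq> (h \<otimes> x \<in> V)"
    by (elim bexE conjE) simp
  have eq: "\<psi> (y \<otimes> g) = \<psi> g + 1" if "g \<in> carrier F" for g
    using \<psi> that unfolding axis_function_def by blast
  have "\<bar>\<psi>' g - \<psi> g - \<psi>' r\<bar> \<le> int (\<Sum>x\<in>X. N x)" if "g \<in> carrier F" for g
    by (rule equivariant_compare[where \<psi> = \<psi> and \<psi>' = \<psi>', OF y eq eq' X basis_subset _ _ r conn that])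
      (simp_all add: fin)
  then show ?thesis by blast
qed

end

context
  fixes F :: "('a, 'b) monoid_scheme" and X and \<Phi> :: "'a \<Rightarrow> 'a"
  assumes basis: "free_group_basis F X" and X: "finite X" and \<Phi>: "\<Phi> \<in> iso F F"
begin

interpretation free_group_basis F X by (rule basis)

interpretation G: group "semidirect_int F \<Phi>" by (rule semidirect_int_group[OF is_group \<Phi>])

lemmas apow_closed = aut_pow_closed[OF is_group \<Phi>]
lemmas apow_mult = aut_pow_mult[OF is_group \<Phi>]
lemmas apow_add = aut_pow_add[OF is_group \<Phi>]
lemmas apow_0 = aut_pow_0[OF is_group \<Phi>]
lemmas apow_1 = aut_pow_1[OF is_group \<Phi>]
lemmas apow_Suc = aut_pow_Suc[OF is_group \<Phi>]

lemma apow_one: "aut_pow F \<Phi> n \<one>\<^bsub>F\<^esub> = \<one>\<^bsub>F\<^esub>"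
  using hom_one[of "aut_pow F \<Phi> n" F F] aut_pow_iso[OF is_group \<Phi>, of n] is_group
  by (simp add: iso_def)

text \<open>The fibre over \<open>m\<close> carries an axis function for \<open>\<Phi>\<^sup>-\<^sup>m x\<close>. Since \<open>\<Phi>\<close> distorts finitely many edges
  by a bounded amount, the axis functions of neighbouring fibres agree up to a shift and a bounded error
  that does not depend on \<open>m\<close>.\<close>

lemma ex_equivariant_lipschitz:
  assumes x: "x \<in> carrier F" "x \<noteq> \<one>\<^bsub>F\<^esub>"
  shows "\<exists>\<phi> :: 'a \<times> int \<Rightarrow> int.
    (\<forall>g\<in>carrier (semidirect_int F \<Phi>). \<phi> ((x, 0) \<otimes>\<^bsub>semidirect_int F \<Phi>\<^esub> g) = \<phi> g + 1) \<and>
    (\<forall>a\<in>carrier (semidirect_int F \<Phi>). \<exists>C. \<forall>g\<in>carrier (semidirect_int F \<Phi>).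
       \<bar>\<phi> (g \<otimes>\<^bsub>semidirect_int F \<Phi>\<^esub> a) - \<phi> g\<bar> \<le> C)"
proof -
  let ?G = "semidirect_int F \<Phi>"
  let ?\<alpha> = "aut_pow F \<Phi>"
  \<comment> \<open>The pair \<open>(g, m)\<close> is t^m \<Phi>^(-m)(g). In the coordinate
    \<Phi>^(-m)(g), left multiplication by \<open>x\<close> becomes left multiplication by
    \<open>y m\<close>, while right multiplication by an element of F stays what it is; so each
    fibre is a copy of the Cayley tree.\<close>
  define y where "y m = ?\<alpha> (- m) x" for m
  have y: "y m \<in> carrier F" for m using x by (simp add: y_def apow_closed)
  have \<alpha>y: "?\<alpha> m (y m) = x" for m
    using apow_add[OF x(1), of m "- m"] by (simp add: y_def apow_0)
  have "y m \<noteq> \<one>\<^bsub>F\<^esub>" for m using \<alpha>y[of m] x(2) apow_one by metis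
  then obtain \<psi> where \<psi>: "\<And>m. axis_function (y m) (\<psi> m)"
    using ex_axis_function[OF y] by metis
  have eq: "\<psi> m (y m \<otimes>\<^bsub>F\<^esub> g) = \<psi> m g + 1" if "g \<in> carrier F" for m g
    using \<psi>[of m] that unfolding axis_function_def by blast
  obtain N where N: "\<And>a y \<psi>. a \<in> carrier F \<Longrightarrow> axis_function y \<psi> \<Longrightarrow>
    finite (coboundary {g. 0 \<le> \<psi> g} a) \<and> card (coboundary {g. 0 \<le> \<psi> g} a) \<le> N a"
    using uniformly_finite_axis_coboundary by metis
  have \<Phi>c: "\<Phi> g \<in> carrier F" if "g \<in> carrier F" for g
    using apow_closed[OF that, of 1] by (simp add: apow_1)
  have \<Phi>m: "\<Phi> (g \<otimes>\<^bsub>F\<^esub> h) = \<Phi> g \<otimes>\<^bsub>F\<^esub> \<Phi> h" if "g \<in> carrier F" "h \<in> carrier F" for g h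
    using apow_mult[OF that, of 1] by (simp add: apow_1)
  have \<Phi>inj: "inj_on \<Phi> (carrier F)" using \<Phi> by (simp add: iso_def bij_betw_def)
  have \<Phi>y: "\<Phi> (y (m + 1)) = y m" for m
    using apow_Suc[OF x(1), of "- (m + 1)"] by (simp add: y_def)
  \<comment> \<open>Pulling back along \<Phi> replaces the step \<open>a\<close> by
    \<open>\<Phi> a\<close>, and \<open>N\<close> bounds the coboundaries for that element in every
    fibre.\<close>
  define M where "M = int (\<Sum>a\<in>X. N (\<Phi> a))"
  have "\<exists>b. \<forall>g\<in>carrier F. \<bar>\<psi> m (\<Phi> g) - \<psi> (m + 1) g - b\<bar> \<le> M" for m
    unfolding M_def
  proof (rule axis_function_compare[OF \<psi> y X])
    show "\<psi> m (\<Phi> (y (m + 1) \<otimes>\<^bsub>F\<^esub> g)) = \<psi> m (\<Phi> g) + 1" if "g \<in> carrier F" for g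
      using that by (simp add: \<Phi>m y \<Phi>y eq \<Phi>c)
    fix a assume "a \<in> X"
    then have a: "a \<in> carrier F" using basis_subset by auto
    have sub: "\<Phi> ` coboundary {g. 0 \<le> \<psi> m (\<Phi> g)} a \<subseteq> coboundary {g. 0 \<le> \<psi> m g} (\<Phi> a)"
      using a by (auto simp: coboundary_def \<Phi>c \<Phi>m)
    have inj: "inj_on \<Phi> (coboundary {g. 0 \<le> \<psi> m (\<Phi> g)} a)"
      using \<Phi>inj by (rule inj_on_subset) (auto simp: coboundary_def)
    have f: "finite (coboundary {g. 0 \<le> \<psi> m g} (\<Phi> a))"
      "card (coboundary {g. 0 \<le> \<psi> m g} (\<Phi> a)) \<le> N (\<Phi> a)"
      using N[OF \<Phi>c[OF a] \<psi>] by blast+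
    show "finite (coboundary {g. 0 \<le> \<psi> m (\<Phi> g)} a) \<and>
      card (coboundary {g. 0 \<le> \<psi> m (\<Phi> g)} a) \<le> N (\<Phi> a)"
      using finite_imageD[OF finite_subset[OF sub f(1)] inj]
        card_mono[OF f(1) sub] card_image[OF inj] f(2) by simp
  qed
  then obtain \<beta> where \<beta>: "\<And>m g. g \<in> carrier F \<Longrightarrow> \<bar>\<psi> m (\<Phi> g) - \<psi> (m + 1) g - \<beta> m\<bar> \<le> M"
    by metis
  \<comment> \<open>The shifts \<open>\<beta>\<close> may be unbounded in \<open>m\<close>; summing
    them into the origins \<open>b\<close> leaves only the errors, which are at most
    \<open>M\<close>.\<close>
  obtain b where b: "\<And>m. b (m + 1) = b m + \<beta> m" using ex_int_antidifference by metis
  define \<phi> where "\<phi> = (\<lambda>(g, m). \<psi> m (?\<alpha> (- m) g) + b m)"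
  have "\<phi> ((x, 0) \<otimes>\<^bsub>?G\<^esub> g) = \<phi> g + 1" if "g \<in> carrier ?G" for g
    using that x eq by (cases g) (simp add: \<phi>_def apow_0 apow_mult apow_closed y_def[symmetric])
  moreover have "\<exists>C. \<forall>g\<in>carrier ?G. \<bar>\<phi> (g \<otimes>\<^bsub>?G\<^esub> a) - \<phi> g\<bar> \<le> C" if a: "a \<in> carrier ?G" for a
  proof -
    \<comment> \<open>The elements with bounded displacement are closed under products and inverses,
      so the fibre group and the stable letter are enough.\<close>
    define L where "L a \<longleftrightarrow> (\<exists>C. \<forall>g\<in>carrier ?G. \<bar>\<phi> (g \<otimes>\<^bsub>?G\<^esub> a) - \<phi> g\<bar> \<le> C)" for a
    have fibre: "L (a, 0)" if a: "a \<in> carrier F" for a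
    proof -
      have "\<bar>\<phi> ((u, m) \<otimes>\<^bsub>?G\<^esub> (a, 0)) - \<phi> (u, m)\<bar> \<le> int (N a)" if u: "u \<in> carrier F" for u m
      proof -
        have "?\<alpha> (- m) (u \<otimes>\<^bsub>F\<^esub> ?\<alpha> m a) = ?\<alpha> (- m) u \<otimes>\<^bsub>F\<^esub> a"
          using apow_add[OF a, of "- m" m] u a by (simp add: apow_mult apow_closed apow_0)
        then have "\<phi> ((u, m) \<otimes>\<^bsub>?G\<^esub> (a, 0)) - \<phi> (u, m) =
            \<psi> m (?\<alpha> (- m) u \<otimes>\<^bsub>F\<^esub> a) - \<psi> m (?\<alpha> (- m) u)"
          by (simp add: \<phi>_def)
        then show ?thesis
          using equivariant_diff_le[where \<psi> = "\<psi> m", OF y eq a, of "N a" "?\<alpha> (- m) u"] N[OF a \<psi>[of m]] u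
          by (simp add: apow_closed)
      qed
      then show ?thesis unfolding L_def by (intro exI[of _ "int (N a)"]) auto
    qed
    have up: "L (\<one>\<^bsub>F\<^esub>, 1)"
    proof -
      have "\<bar>\<phi> ((u, m) \<otimes>\<^bsub>?G\<^esub> (\<one>\<^bsub>F\<^esub>, 1)) - \<phi> (u, m)\<bar> \<le> M" if u: "u \<in> carrier F" for u m
      proof -
        have "?\<alpha> (- m) u = \<Phi> (?\<alpha> (- (m + 1)) u)"
          using apow_Suc[OF u, of "- (m + 1)"] by simp
        then have "\<phi> ((u, m) \<otimes>\<^bsub>?G\<^esub> (\<one>\<^bsub>F\<^esub>, 1)) - \<phi> (u, m) =
            - (\<psi> m (\<Phi> (?\<alpha> (- (m + 1)) u)) - \<psi> (m + 1) (?\<alpha> (- (m + 1)) u) - \<beta> m)"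
          using u b by (simp add: \<phi>_def apow_one)
        then show ?thesis using \<beta>[OF apow_closed[OF u, of "- (m + 1)"], of m] by linarith
      qed
      then show ?thesis unfolding L_def by (intro exI[of _ M]) auto
    qed
    have mult: "L (a \<otimes>\<^bsub>?G\<^esub> c)" if La: "L a" and Lc: "L c" and ac: "a \<in> carrier ?G" "c \<in> carrier ?G" for a c
    proof -
      obtain A C where AC: "\<And>g. g \<in> carrier ?G \<Longrightarrow> \<bar>\<phi> (g \<otimes>\<^bsub>?G\<^esub> a) - \<phi> g\<bar> \<le> A"
        "\<And>g. g \<in> carrier ?G \<Longrightarrow> \<bar>\<phi> (g \<otimes>\<^bsub>?G\<^esub> c) - \<phi> g\<bar> \<le> C"
        using La Lc unfolding L_def by blast
      have "\<bar>\<phi> (g \<otimes>\<^bsub>?G\<^esub> (a \<otimes>\<^bsub>?G\<^esub> c)) - \<phi> g\<bar> \<le> A + C" if g: "g \<in> carrier ?G" for g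
      proof -
        have e: "g \<otimes>\<^bsub>?G\<^esub> (a \<otimes>\<^bsub>?G\<^esub> c) = g \<otimes>\<^bsub>?G\<^esub> a \<otimes>\<^bsub>?G\<^esub> c"
          using G.m_assoc[OF g ac] by simp
        show ?thesis
          unfolding e using AC(1)[OF g] AC(2)[OF G.m_closed[OF g ac(1)]] by arith
      qed
      then show ?thesis unfolding L_def by blast
    qed
    have invs: "L (inv\<^bsub>?G\<^esub> a)" if La: "L a" and a: "a \<in> carrier ?G" for a
    proof -
      obtain A where A: "\<And>g. g \<in> carrier ?G \<Longrightarrow> \<bar>\<phi> (g \<otimes>\<^bsub>?G\<^esub> a) - \<phi> g\<bar> \<le> A"
        using La unfolding L_def by blast
      have "\<bar>\<phi> (g \<otimes>\<^bsub>?G\<^esub> inv\<^bsub>?G\<^esub> a) - \<phi> g\<bar> \<le> A" if g: "g \<in> carrier ?G" for g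
      proof -
        have i: "inv\<^bsub>?G\<^esub> a \<in> carrier ?G" using G.inv_closed[OF a] .
        have "g \<otimes>\<^bsub>?G\<^esub> inv\<^bsub>?G\<^esub> a \<otimes>\<^bsub>?G\<^esub> a = g"
          using G.m_assoc[OF g i a] G.l_inv[OF a] G.r_one[OF g] by metis
        then show ?thesis using A[OF G.m_closed[OF g i]] by (metis abs_minus_commute)
      qed
      then show ?thesis unfolding L_def by blast
    qed
    have t: "(\<one>\<^bsub>F\<^esub>, 1) \<in> carrier ?G" "(\<one>\<^bsub>F\<^esub>, - 1) \<in> carrier ?G" by simp_all
    have "inv\<^bsub>?G\<^esub> (\<one>\<^bsub>F\<^esub>, 1) = (\<one>\<^bsub>F\<^esub>, - 1)"
      by (rule G.inv_equality) (simp_all add: apow_one)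
    then have down: "L (\<one>\<^bsub>F\<^esub>, - 1)" using invs[OF up t(1)] by simp
    have "L (u, n)" if u: "u \<in> carrier F" for u n
    proof (induction n rule: int_induct[where k = 0])
      case base
      show ?case by (rule fibre[OF u])
    next
      case (step1 i)
      have "(u, i + 1) = (u, i) \<otimes>\<^bsub>?G\<^esub> (\<one>\<^bsub>F\<^esub>, 1)" using u by (simp add: apow_one)
      then show ?case using mult[OF step1(2) up] u t by simp
    next
      case (step2 i)
      have "(u, i - 1) = (u, i) \<otimes>\<^bsub>?G\<^esub> (\<one>\<^bsub>F\<^esub>, - 1)" using u by (simp add: apow_one)
      then show ?case using mult[OF step2(2) down] u t by simp
    qed
    then show ?thesis using a unfolding L_def[symmetric] by (cases a) auto
  qed
  ultimately show ?thesis by blast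
qed

end

section \<open>Slender subgroups of free groups are cyclic\<close>

context group
begin

lemma int_hom_int_pow:
  fixes f :: "'a \<Rightarrow> int"
  assumes K: "subgroup K G" and f: "\<And>a b. a \<in> K \<Longrightarrow> b \<in> K \<Longrightarrow> f (a \<otimes> b) = f a + f b" and k: "k \<in> K"
  shows "f (k [^] (n::int)) = n * f k"
proof -
  have kc: "k \<in> carrier G" using subgroup.mem_carrier[OF K k] .
  have pw: "k [^] (i::int) \<in> K" for i using subgroup_int_pow_closed[OF K k] .
  have one: "f \<one> = 0" using f[of \<one> \<one>] subgroup.one_closed[OF K] by simp
  show ?thesis
  proof (induction n rule: int_induct[where k = 0])
    case base
    show ?case using one by simp
  next
    case (step1 i)
    have "k [^] (i + 1) = k [^] i \<otimes> k" using int_pow_mult[OF kc, of i 1] kc by simp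
    then show ?case using step1 f[OF pw k] by (simp add: algebra_simps)
  next
    case (step2 i)
    have "k [^] i = k [^] (i - 1) \<otimes> k" using int_pow_mult[OF kc, of "i - 1" 1] kc by simp
    then show ?case using step2 f[OF pw k, of "i - 1"] by (simp add: algebra_simps)
  qed
qed

text \<open>A least positive value of \<open>f\<close> divides all values. The bound on
  \<open>q\<close> holds because this value is at least 1; if \<open>f\<close> vanishes on
  \<open>K\<close>, it selects \<open>q = 0\<close>.\<close>

lemma int_hom_generator:
  fixes f :: "'a \<Rightarrow> int"
  assumes K: "subgroup K G" and f: "\<And>a b. a \<in> K \<Longrightarrow> b \<in> K \<Longrightarrow> f (a \<otimes> b) = f a + f b"
  shows "\<exists>k0\<in>K. \<forall>k\<in>K. \<exists>q. f k = q * f k0 \<and> \<bar>q\<bar> \<le> \<bar>f k\<bar>"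
proof (cases "\<exists>k\<in>K. f k \<noteq> 0")
  case False
  then show ?thesis using subgroup.one_closed[OF K] by (intro bexI[of _ \<one>]) auto
next
  case True
  then obtain k where k: "k \<in> K" "f k \<noteq> 0" by blast
  have pw: "h [^] (i::int) \<in> K" if "h \<in> K" for i h using subgroup_int_pow_closed[OF K that] .
  have fpw: "f (h [^] (i::int)) = i * f h" if "h \<in> K" for i h
    by (rule int_hom_int_pow[OF K f that])
  have "\<exists>k\<in>K. 0 < f k"
    using k fpw[OF k(1), of "sgn (f k)"] pw[OF k(1), of "sgn (f k)"]
    by (intro bexI[of _ "k [^] sgn (f k)"]) (auto simp: sgn_if)
  then obtain k1 where k1: "k1 \<in> K \<and> 0 < f k1" by blast
  from ex_has_least_nat[of "\<lambda>k. k \<in> K \<and> 0 < f k", OF this, of "\<lambda>k. nat (f k)"]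
  obtain k0 where k0: "k0 \<in> K" "0 < f k0" and min: "\<And>h. h \<in> K \<Longrightarrow> 0 < f h \<Longrightarrow> f k0 \<le> f h"
    by (metis nat_le_eq_zle)
  have "\<exists>q. f h = q * f k0 \<and> \<bar>q\<bar> \<le> \<bar>f h\<bar>" if h: "h \<in> K" for h
  proof -
    let ?q = "f h div f k0"
    have "f (k0 [^] (- ?q) \<otimes> h) = f h mod f k0"
      using f[OF pw[OF k0(1)] h, of "- ?q"] fpw[OF k0(1), of "- ?q"]
      by (simp add: minus_div_mult_eq_mod[symmetric])
    moreover have "k0 [^] (- ?q) \<otimes> h \<in> K" using subgroup.m_closed[OF K pw[OF k0(1)] h] .
    ultimately have "f h mod f k0 = 0"
      using min[of "k0 [^] (- ?q) \<otimes> h"] k0(2) pos_mod_bound[OF k0(2), of "f h"]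
        pos_mod_sign[OF k0(2), of "f h"] by linarith
    then have e: "f h = ?q * f k0" by (metis add.right_neutral div_mult_mod_eq)
    then have "\<bar>f h\<bar> = \<bar>?q\<bar> * f k0" using k0(2) by (metis abs_mult abs_of_pos)
    moreover have "\<bar>?q\<bar> * 1 \<le> \<bar>?q\<bar> * f k0" using k0(2) by (intro mult_left_mono) auto
    ultimately show ?thesis using e by (intro exI[of _ ?q]) auto
  qed
  then show ?thesis using k0(1) by blast
qed

text \<open>The signed number of \<open>N\<close>-translates of \<open>U\<close> that are entered on the way from \<open>p\<close> to \<open>q\<close>.\<close>

definition crossing :: "'a set \<Rightarrow> 'a set \<Rightarrow> 'a \<Rightarrow> 'a \<Rightarrow> int" where
  "crossing N U p q =
     (\<Sum>m \<in> {m \<in> N. (m \<otimes> p \<in> U) \<noteq> (m \<otimes> q \<in> U)}. of_bool (m \<otimes> q \<in> U) - of_bool (m \<otimes> p \<in> U))"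

lemma crossing_refl [simp]: "crossing N U p p = 0"
  by (simp add: crossing_def)

lemma crossing_nonzeroD:
  assumes "crossing N U p q \<noteq> 0"
  shows "\<exists>m\<in>N. (m \<otimes> p \<in> U) \<noteq> (m \<otimes> q \<in> U)"
proof (rule ccontr)
  assume "\<not> ?thesis"
  then have e: "{m \<in> N. (m \<otimes> p \<in> U) \<noteq> (m \<otimes> q \<in> U)} = {}" by blast
  have "crossing N U p q = 0" unfolding crossing_def e by simp
  then show False using assms by simp
qed

context
  fixes N U
  assumes N: "subgroup N G" and U: "\<And>a. a \<in> carrier G \<Longrightarrow> finite (coboundary U a)"
begin

lemma finite_crossing:
  assumes p: "p \<in> carrier G" and q: "q \<in> carrier G"
  shows "finite {m \<in> N. (m \<otimes> p \<in> U) \<noteq> (m \<otimes> q \<in> U)}" (is "finite ?S")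
proof -
  have Nc: "m \<in> carrier G" if "m \<in> N" for m using subgroup.mem_carrier[OF N that] .
  have sub: "(\<lambda>m. m \<otimes> p) ` ?S \<subseteq> coboundary U (inv p \<otimes> q)"
    using p q Nc by (auto simp: coboundary_def m_assoc)
  have fin: "finite (coboundary U (inv p \<otimes> q))" using p q by (intro U) simp
  have inj: "inj_on (\<lambda>m. m \<otimes> p) ?S" using p Nc by (auto simp: inj_on_def)
  show ?thesis by (rule finite_imageD[OF finite_subset[OF sub fin] inj])
qed

lemma crossing_trans:
  assumes p: "p \<in> carrier G" and q: "q \<in> carrier G" and r: "r \<in> carrier G"
  shows "crossing N U p q + crossing N U q r = crossing N U p r"
proof -
  define A where "A = {m \<in> N. (m \<otimes> p \<in> U) \<noteq> (m \<otimes> q \<in> U)} \<union> {m \<in> N. (m \<otimes> q \<in> U) \<noteq> (m \<otimes> r \<in> U)}"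
  have fA: "finite A" unfolding A_def using finite_crossing[OF p q] finite_crossing[OF q r] by simp
  have *: "crossing N U a b = (\<Sum>m\<in>A. of_bool (m \<otimes> b \<in> U) - of_bool (m \<otimes> a \<in> U))"
    if "{m \<in> N. (m \<otimes> a \<in> U) \<noteq> (m \<otimes> b \<in> U)} \<subseteq> A" for a b
    unfolding crossing_def
    by (rule sum.mono_neutral_left[OF fA that]) (auto simp: A_def)
  have "{m \<in> N. (m \<otimes> p \<in> U) \<noteq> (m \<otimes> q \<in> U)} \<subseteq> A" "{m \<in> N. (m \<otimes> q \<in> U) \<noteq> (m \<otimes> r \<in> U)} \<subseteq> A"
    "{m \<in> N. (m \<otimes> p \<in> U) \<noteq> (m \<otimes> r \<in> U)} \<subseteq> A"
    by (auto simp: A_def)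
  then show ?thesis by (simp add: * sum.distrib[symmetric])
qed

lemma crossing_shift:
  assumes n: "n \<in> N" and p: "p \<in> carrier G" and q: "q \<in> carrier G"
  shows "crossing N U (n \<otimes> p) (n \<otimes> q) = crossing N U p q"
proof -
  have Nc: "m \<in> carrier G" if "m \<in> N" for m using subgroup.mem_carrier[OF N that] .
  have Nm: "m \<otimes> n \<in> N" "m \<otimes> inv n \<in> N" if "m \<in> N" for m
    using that n subgroup.m_closed[OF N] subgroup.m_inv_closed[OF N] by auto
  show ?thesis unfolding crossing_def
    by (rule sum.reindex_bij_witness[where i = "\<lambda>m. m \<otimes> inv n" and j = "\<lambda>m. m \<otimes> n"])
      (use n p q Nc Nm in \<open>auto simp: m_assoc\<close>)
qed

text \<open>The path from \<open>\<one>\<close> to \<open>m \<otimes> n\<close> splits at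
  \<open>m\<close>, and its second half is the translate by \<open>m\<close> of the path from
  \<open>\<one>\<close> to \<open>n\<close>. Topologically, a cocycle supported on the border of
  \<open>U\<close> is evaluated on loops in the quotient by \<open>N\<close>.\<close>

lemma crossing_hom:
  assumes "m \<in> N" "n \<in> N"
  shows "crossing N U \<one> (m \<otimes> n) = crossing N U \<one> m + crossing N U \<one> n"
proof -
  have c: "m \<in> carrier G" "n \<in> carrier G" using assms subgroup.mem_carrier[OF N] by auto
  show ?thesis
    using crossing_trans[of \<one> m "m \<otimes> n"] crossing_shift[OF assms(1), of \<one> n] c by simp
qed

text \<open>The paths from \<open>\<one>\<close> to \<open>p\<close> and from \<open>n\<close> to
  \<open>n \<otimes> p\<close> are translates, so their counts cancel. The point \<open>p\<close>
  may lie outside \<open>N\<close>, as the start of a shortest closed path usually does.\<close>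

lemma crossing_basepoint:
  assumes n: "n \<in> N" and p: "p \<in> carrier G"
  shows "crossing N U p (n \<otimes> p) = crossing N U \<one> n"
proof -
  have c: "n \<in> carrier G" using n subgroup.mem_carrier[OF N] by auto
  show ?thesis
    using crossing_trans[of p \<one> "n \<otimes> p"] crossing_trans[of \<one> n "n \<otimes> p"]
      crossing_trans[of p \<one> p] crossing_shift[OF n, of \<one> p] c p by simp
qed

end

end

context free_group_basis
begin

text \<open>A minimal closed path in the quotient of the Cayley tree by \<open>N\<close> is simple, so it passes through
  its first edge exactly once.\<close>

lemma ex_crossing_nonzero:
  assumes N: "subgroup N F" and ne: "n0 \<in> N" "n0 \<noteq> \<one>"
  obtains U n where "n \<in> N" "crossing N U \<one> n \<noteq> 0"
    "\<And>a. a \<in> carrier F \<Longrightarrow> finite (coboundary U a)"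
proof -
  obtain p n where p: "p \<in> carrier F" and n: "n \<in> N" "n \<noteq> \<one>"
    and min: "\<And>q m. q \<in> carrier F \<Longrightarrow> m \<in> N \<Longrightarrow> m \<noteq> \<one> \<Longrightarrow>
       length (nf (inv p \<otimes> n \<otimes> p)) \<le> length (nf (inv q \<otimes> m \<otimes> q))"
    using ex_minimal_conjugate[OF ne] by metis
  have Nc: "m \<in> carrier F" if "m \<in> N" for m using subgroup.mem_carrier[OF N that] .
  define c where "c = nf (inv p \<otimes> n \<otimes> p)"
  define s where "s = hd c"
  have ccr: "inv p \<otimes> n \<otimes> p \<in> carrier F" using p n Nc by simp
  have c: "c \<noteq> []" "hd c \<noteq> inv_letter (last c)"
    using minimal_conjugate[OF p Nc[OF n(1)] n(2) min[OF _ n] c_def] by auto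
  have cl: "set c \<subseteq> letters" "is_reduced c" and vc: "val c = inv p \<otimes> n \<otimes> p"
    unfolding c_def by (rule nf_letters[OF ccr] nf_reduced[OF ccr] val_nf[OF ccr])+
  have s: "s \<in> letters" using c cl by (auto simp: s_def)
  let ?U = "halfspace p s"
  have fin: "finite (coboundary ?U a)" if "a \<in> carrier F" for a
    using uniformly_finite_coboundary[OF that] p s by metis
  \<comment> \<open>For nontrivial \<open>m\<close>, a translate of the path that meets
    \<open>p\<close> after \<open>i\<close> steps exhibits the prefix of length \<open>i\<close> as
    a conjugate of \<open>inv m\<close>; minimality then forbids
    \<open>i < length c\<close>.\<close>
  have pref: "m = \<one> \<or> length c \<le> i" if m: "m \<in> N" and i: "i \<le> length c"
    and e: "m \<otimes> p \<otimes> val (take i c) = p" for m i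
  proof (cases "m = \<one>")
    case False
    have t: "set (take i c) \<subseteq> letters" "is_reduced (take i c)"
      using cl set_take_subset[of i c] is_reduced_append[of "take i c" "drop i c"] by auto
    then have v: "val (take i c) \<in> carrier F" by simp
    have im: "inv m \<in> N" using subgroup.m_inv_closed[OF N m] .
    have "inv m \<noteq> \<one>" using False Nc[OF m] by simp
    have "inv p \<otimes> (inv m \<otimes> p) = inv p \<otimes> (inv m \<otimes> (m \<otimes> p \<otimes> val (take i c)))"
      using e by simp
    also have "\<dots> = val (take i c)" using p Nc[OF m] v by (simp add: m_assoc)
    finally have "inv p \<otimes> inv m \<otimes> p = val (take i c)" using p Nc[OF m] by (simp add: m_assoc)
    then have "nf (inv p \<otimes> inv m \<otimes> p) = take i c" using t by simp
    then show ?thesis using min[OF p im \<open>inv m \<noteq> \<one>\<close>] by (simp add: c_def[symmetric])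
  qed simp
  \<comment> \<open>A nontrivial translate of the path never uses the edge between \<open>p\<close>
    and \<open>p \<otimes> lval s\<close>. Forwards it would meet \<open>p\<close> before its end;
    backwards it would meet \<open>p\<close> exactly at its end, and then the last letter of
    \<open>c\<close> would cancel the first.\<close>
  have same: "(m \<otimes> p \<in> ?U) \<longleftrightarrow> (m \<otimes> p \<otimes> val (take i c) \<in> ?U)"
    if m: "m \<in> N" "m \<noteq> \<one>" and i: "i \<le> length c" for m i
    using i
  proof (induction i)
    case 0
    then show ?case using p Nc[OF m(1)] by simp
  next
    case (Suc i)
    let ?g = "m \<otimes> p \<otimes> val (take i c)" and ?l = "c ! i"
    have l: "?l \<in> letters" using cl Suc.prems by (meson Suc_le_lessD nth_mem subsetD)
    have tl: "set (take i c) \<subseteq> letters" using cl set_take_subset[of i c] by auto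
    have g: "?g \<in> carrier F" using p Nc[OF m(1)] tl by simp
    have tk: "take (Suc i) c = take i c @ [?l]" using Suc.prems by (simp add: take_Suc_conv_app_nth)
    have e: "m \<otimes> p \<otimes> val (take (Suc i) c) = ?g \<otimes> lval ?l"
      unfolding tk using val_append[OF tl, of "[?l]"] l p Nc[OF m(1)] tl by (simp add: m_assoc)
    have "(?g \<in> ?U) = (?g \<otimes> lval ?l \<in> ?U)"
    proof (rule ccontr)
      assume "\<not> ?thesis"
      then consider "?g = p" | "?g = p \<otimes> lval s" "?l = inv_letter s"
        using halfspace_edge[OF p s g l] by metis
      then show False
      proof cases
        case 1
        then show False using pref[OF m(1) _ 1] m Suc.prems by simp
      next
        case 2
        have "m \<otimes> p \<otimes> val (take (Suc i) c) = p"
          unfolding e 2 using p s by (simp add: lval_inv_letter m_assoc)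
        then have "length c = Suc i" using pref[OF m(1) Suc.prems] m Suc.prems by simp
        then have "last c = inv_letter s" using 2(2) c(1) by (simp add: last_conv_nth)
        then show False using c(2) by (simp add: s_def)
      qed
    qed
    then show ?case using Suc e by simp
  qed
  have np: "m \<otimes> (n \<otimes> p) = m \<otimes> p \<otimes> val (take (length c) c)" if "m \<in> N" for m
    using p Nc[OF that] Nc[OF n(1)] by (simp add: vc m_assoc)
  have U0: "\<one> \<otimes> p \<notin> ?U" using p by (simp add: halfspace_def)
  have U1: "\<one> \<otimes> (n \<otimes> p) \<in> ?U"
    using p Nc[OF n(1)] c by (simp add: halfspace_def m_assoc[symmetric] c_def[symmetric] s_def[symmetric])
  have "(m \<otimes> p \<in> ?U) \<noteq> (m \<otimes> (n \<otimes> p) \<in> ?U) \<longleftrightarrow> m = \<one>" if "m \<in> N" for m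
  proof (cases "m = \<one>")
    case True
    then show ?thesis using U0 U1 by metis
  next
    case False
    then show ?thesis using same[OF that False order_refl] np[OF that] by metis
  qed
  then have e: "{m \<in> N. (m \<otimes> p \<in> ?U) \<noteq> (m \<otimes> (n \<otimes> p) \<in> ?U)} = {\<one>}"
    using subgroup.one_closed[OF N] by blast
  have "crossing N ?U p (n \<otimes> p) = 1" unfolding crossing_def e using U0 U1 by simp
  then have "crossing N ?U \<one> n \<noteq> 0" using crossing_basepoint[OF N fin n(1) p] by simp
  then show ?thesis using that n(1) fin by blast
qed

text \<open>Let \<open>\<chi>\<close> be a nonzero crossing homomorphism of \<open>K\<close> and \<open>L\<close> its kernel. If \<open>L\<close> were nontrivial, then
  a nonzero crossing homomorphism of \<open>L\<close> would be nonzero on a generator of \<open>L\<close> based at any point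
  \<open>k\<^sup>-\<^sup>1\<close> with \<open>k \<in> K\<close>. So finitely many edges would meet every coset of \<open>L\<close> in \<open>K\<close>.\<close>

theorem noetherian_subgroup_cyclic:
  assumes K: "subgroup K F"
    and noeth: "\<And>L. subgroup L F \<Longrightarrow> L \<subseteq> K \<Longrightarrow> \<exists>S. finite S \<and> S \<subseteq> L \<and> generate F S = L"
  shows "\<exists>x\<in>K. \<forall>k\<in>K. \<exists>i::int. k = x [^] i"
proof (cases "K = {\<one>}")
  case True
  then show ?thesis by (auto intro!: exI[of _ "0::int"])
next
  case False
  then obtain n1 where n1: "n1 \<in> K" "n1 \<noteq> \<one>" using subgroup.one_closed[OF K] by blast
  obtain U k0 where k0: "k0 \<in> K" "crossing K U \<one> k0 \<noteq> 0"
    and fU: "\<And>a. a \<in> carrier F \<Longrightarrow> finite (coboundary U a)"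
    using ex_crossing_nonzero[OF K n1] by blast
  define \<chi> where "\<chi> = crossing K U \<one>"
  have \<chi>: "\<chi> (a \<otimes> b) = \<chi> a + \<chi> b" if "a \<in> K" "b \<in> K" for a b
    unfolding \<chi>_def by (rule crossing_hom[OF K fU that])
  have \<chi>0: "\<chi> k0 \<noteq> 0" using k0 by (simp add: \<chi>_def)
  have \<chi>1: "\<chi> \<one> = 0" by (simp add: \<chi>_def)
  have Kc: "k \<in> carrier F" if "k \<in> K" for k using subgroup.mem_carrier[OF K that] .
  have Kinv: "inv k \<in> K" if "k \<in> K" for k using subgroup.m_inv_closed[OF K that] .
  have Km: "a \<otimes> b \<in> K" if "a \<in> K" "b \<in> K" for a b using subgroup.m_closed[OF K that] .
  have Kpow: "k [^] (i::int) \<in> K" if "k \<in> K" for k i using subgroup_int_pow_closed[OF K that] .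
  have \<chi>inv: "\<chi> (inv k) = - \<chi> k" if "k \<in> K" for k
    using \<chi>[OF Kinv[OF that] that] \<chi>1 Kc[OF that] by simp
  define L where "L = {k \<in> K. \<chi> k = 0}"
  have L: "subgroup L F"
    by (rule subgroupI) (use Kc Km Kinv \<chi> \<chi>inv \<chi>1 subgroup.one_closed[OF K] in \<open>auto simp: L_def\<close>)
  have conj: "q \<otimes> l \<otimes> inv q \<in> L" if "q \<in> K" "l \<in> L" for q l
    using that by (simp add: L_def Km Kinv \<chi> \<chi>inv)
  have LK: "l \<in> K" if "l \<in> L" for l using that by (simp add: L_def)
  have triv: "L = {\<one>}"
  proof (rule ccontr)
    assume "L \<noteq> {\<one>}"
    then obtain l1 where l1: "l1 \<in> L" "l1 \<noteq> \<one>" using subgroup.one_closed[OF L] by blast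
    obtain V n where n: "n \<in> L" "crossing L V \<one> n \<noteq> 0"
      and fV: "\<And>a. a \<in> carrier F \<Longrightarrow> finite (coboundary V a)"
      using ex_crossing_nonzero[OF L l1] by blast
    obtain S where S: "finite S" "S \<subseteq> L" "generate F S = L" using noeth[OF L] LK by blast
    define E where "E = (\<Union>a\<in>S. coboundary V a)"
    have fE: "finite E" using S fV Kc LK by (auto simp: E_def)
    \<comment> \<open>Counts add up along a product. The second piece starts at
      \<open>q \<otimes> h\<close> and is moved back to \<open>q\<close> by
      \<open>q \<otimes> h \<otimes> inv q\<close>, which lies in \<open>L\<close> because
      \<open>L\<close> is normal in \<open>K\<close>.\<close>
    have zero: "crossing L V q (q \<otimes> l) = 0"
      if q: "q \<in> K" and z: "\<And>a. a \<in> S \<Longrightarrow> crossing L V q (q \<otimes> a) = 0" and l: "l \<in> generate F S" for q l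
      using l
    proof (induction rule: generate.induct)
      case one
      show ?case using q Kc by simp
    next
      case (incl h)
      then show ?case using z by simp
    next
      case (inv h)
      then have h: "h \<in> L" "h \<in> carrier F" using S LK Kc by auto
      have qc: "q \<in> carrier F" using q Kc by simp
      have "crossing L V (q \<otimes> h) q = crossing L V (q \<otimes> h \<otimes> inv q \<otimes> q) (q \<otimes> h \<otimes> inv q \<otimes> (q \<otimes> inv h))"
        using qc h by (simp add: m_assoc)
      also have "\<dots> = crossing L V q (q \<otimes> inv h)"
        using crossing_shift[OF L fV conj[OF q h(1)], of q "q \<otimes> inv h"] qc h by simp
      finally show ?case
        using crossing_trans[OF L fV, of q "q \<otimes> h" q] qc h z[OF inv] by simp
    next
      case (eng h1 h2)
      then have h: "h1 \<in> L" "h2 \<in> L" "h1 \<in> carrier F" "h2 \<in> carrier F" using S LK Kc by auto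
      have qc: "q \<in> carrier F" using q Kc by simp
      have "crossing L V (q \<otimes> h1) (q \<otimes> (h1 \<otimes> h2)) =
          crossing L V (q \<otimes> h1 \<otimes> inv q \<otimes> q) (q \<otimes> h1 \<otimes> inv q \<otimes> (q \<otimes> h2))"
        using qc h by (simp add: m_assoc)
      also have "\<dots> = crossing L V q (q \<otimes> h2)"
        using crossing_shift[OF L fV conj[OF q h(1)], of q "q \<otimes> h2"] qc h by simp
      finally show ?case
        using crossing_trans[OF L fV, of q "q \<otimes> h1" "q \<otimes> (h1 \<otimes> h2)"] qc h eng.IH by simp
    qed
    \<comment> \<open>The count from \<open>q\<close> to \<open>n \<otimes> q\<close> is nonzero, so
      some generator in \<open>S\<close> already gives a crossing at \<open>q\<close>. A translate
      of that edge by \<open>L\<close> lies in \<open>E\<close>, and \<open>\<chi>\<close> does not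
      notice the translation. As \<open>i\<close> varies, \<open>E\<close> would have to take
      infinitely many values.\<close>
    have "\<exists>e\<in>E. \<chi> e = - int i * \<chi> k0" for i
    proof -
      define q where "q = inv (k0 [^] int i)"
      have q: "q \<in> K" unfolding q_def by (intro Kinv Kpow k0)
      have \<chi>q: "\<chi> q = - int i * \<chi> k0"
        unfolding q_def using \<chi>inv[OF Kpow[OF k0(1)]] int_hom_int_pow[of K \<chi>, OF K \<chi> k0(1)] by simp
      have qc: "q \<in> carrier F" "n \<in> carrier F" using q n LK Kc by auto
      have "inv q \<otimes> n \<otimes> inv (inv q) \<in> L" using conj[OF Kinv[OF q] n(1)] .
      then have "inv q \<otimes> n \<otimes> q \<in> generate F S" using qc S by simp
      moreover have "q \<otimes> (inv q \<otimes> n \<otimes> q) = n \<otimes> q" using qc by (simp add: m_assoc)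
      moreover have "crossing L V q (n \<otimes> q) \<noteq> 0"
        using crossing_basepoint[OF L fV n(1) qc(1)] n(2) by simp
      ultimately obtain a where a: "a \<in> S" "crossing L V q (q \<otimes> a) \<noteq> 0"
        using zero[OF q, of "inv q \<otimes> n \<otimes> q"] by metis
      obtain m where m: "m \<in> L" "(m \<otimes> q \<in> V) \<noteq> (m \<otimes> (q \<otimes> a) \<in> V)"
        using crossing_nonzeroD[OF a(2)] by blast
      have "a \<in> carrier F" "m \<in> carrier F" using a m S LK Kc by auto
      then have "m \<otimes> q \<in> coboundary V a"
        using m qc by (simp add: coboundary_def m_assoc)
      then have "m \<otimes> q \<in> E" using a by (auto simp: E_def)
      moreover have "\<chi> (m \<otimes> q) = - int i * \<chi> k0"
        using \<chi>[OF LK[OF m(1)] q] \<chi>q m(1) by (simp add: L_def)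
      ultimately show ?thesis by blast
    qed
    then obtain e where e: "\<And>i. e i \<in> E \<and> \<chi> (e i) = - int i * \<chi> k0" by metis
    have "inj e"
    proof (rule injI)
      fix i j assume "e i = e j"
      then have "- int i * \<chi> k0 = - int j * \<chi> k0" using e by metis
      then show "i = j" using \<chi>0 by simp
    qed
    then have "infinite (range e)" using finite_imageD by blast
    then show False using fE e finite_subset[of "range e" E] by blast
  qed
  \<comment> \<open>With trivial kernel, \<open>\<chi>\<close> identifies \<open>K\<close> with a
    group of integers.\<close>
  obtain x where x: "x \<in> K" "\<forall>k\<in>K. \<exists>q. \<chi> k = q * \<chi> x \<and> \<bar>q\<bar> \<le> \<bar>\<chi> k\<bar>"
    using int_hom_generator[of K \<chi>, OF K \<chi>] by blast
  have "\<exists>i::int. k = x [^] i" if k: "k \<in> K" for k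
  proof -
    obtain q where q: "\<chi> k = q * \<chi> x" using x k by blast
    have "x [^] (- q) \<otimes> k \<in> L"
      using q k x Kpow Km int_hom_int_pow[of K \<chi>, OF K \<chi> x(1)] by (simp add: L_def \<chi>)
    then have "inv (x [^] q) \<otimes> k = \<one>" using triv Kc[OF x(1)] by (simp add: int_pow_neg)
    then have "k = x [^] q" using Kc[OF k] Kc[OF x(1)]
      by (metis int_pow_closed inv_closed inv_equality inv_inv)
    then show ?thesis by blast
  qed
  then show ?thesis using x(1) by blast
qed

end

section \<open>Distances in Cayley graphs\<close>

text \<open>Either end of the edge would do; it lies within distance 1, so estimates at vertices
  suffice.\<close>

fun base_vertex :: "('v, 'e) pre_digraph \<Rightarrow> ('v, 'e) graph_point \<Rightarrow> 'v" where
  "base_vertex \<Gamma> (Vertex v) = v"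
| "base_vertex \<Gamma> (Interior e s) = tail \<Gamma> e"

locale cayley = group G for G (structure) +
  fixes S
  assumes gens: "S \<subseteq> carrier G" and gen: "generate G S = carrier G"
begin

abbreviation adj where
  "adj \<equiv> arcs_ends (cayley_graph G S) \<union> (arcs_ends (cayley_graph G S))\<inverse>"

abbreviation vd where "vd \<equiv> vertex_dist (cayley_graph G S)"

lemma arcs_ends_cayley: "arcs_ends (cayley_graph G S) = {(g, g \<otimes> s) | g s. g \<in> carrier G \<and> s \<in> S}"
  unfolding arcs_ends_conv by (auto simp: cayley_graph_def image_iff)

lemma adjI: "g \<in> carrier G \<Longrightarrow> s \<in> S \<Longrightarrow> (g, g \<otimes> s) \<in> adj \<and> (g \<otimes> s, g) \<in> adj"
  unfolding arcs_ends_cayley by blast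

lemma adjE:
  assumes "(u, v) \<in> adj"
  obtains s where "u \<in> carrier G" "v \<in> carrier G" "s \<in> S" "v = u \<otimes> s \<or> u = v \<otimes> s"
  using assms gens unfolding arcs_ends_cayley by blast

lemma relpow_vd:
  "u \<in> carrier G \<Longrightarrow> v \<in> carrier G \<Longrightarrow> (u, v) \<in> adj ^^ vd u v"
  unfolding vertex_dist_def
  using cayley_graph_connected[OF is_group gens gen] by (rule LeastI_ex)

lemma vd_le: "(u, v) \<in> adj ^^ n \<Longrightarrow> vd u v \<le> n"
  unfolding vertex_dist_def by (rule Least_le)

lemma vd_self [simp]: "vd u u = 0"
  using vd_le[of u u 0] by simp

lemma vd_triangle:
  assumes "u \<in> carrier G" "v \<in> carrier G" "w \<in> carrier G"
  shows "vd u w \<le> vd u v + vd v w"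
  using relpow_trans[OF relpow_vd relpow_vd] assms by (intro vd_le) blast

lemma vd_generator:
  assumes "g \<in> carrier G" "s \<in> S"
  shows "vd g (g \<otimes> s) \<le> 1" and "vd (g \<otimes> s) g \<le> 1"
  using adjI[OF assms] by (auto intro!: vd_le)

text \<open>Lower bounds for distances come from here, with \<open>f\<close> the projection to the
  integers or the equivariant function. Applied in a subgroup to the distance of the ambient group,
  it bounds that distance from above.\<close>

lemma vd_lipschitz:
  fixes f :: "'a \<Rightarrow> int"
  assumes "\<And>g s. g \<in> carrier G \<Longrightarrow> s \<in> S \<Longrightarrow> \<bar>f (g \<otimes> s) - f g\<bar> \<le> C"
    and "u \<in> carrier G" "v \<in> carrier G"
  shows "\<bar>f v - f u\<bar> \<le> C * int (vd u v)"
proof -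
  have "\<bar>f v - f u\<bar> \<le> C * int n" if "(u, v) \<in> adj ^^ n" for n v
    using that
  proof (induction n arbitrary: v)
    case 0
    then show ?case by simp
  next
    case (Suc n)
    then obtain w where w: "(u, w) \<in> adj ^^ n" "(w, v) \<in> adj" by auto
    have "\<bar>f v - f w\<bar> \<le> C"
      using w(2) by (rule adjE) (use assms(1) abs_minus_commute in metis)
    then show ?case using Suc.IH[OF w(1)] by (simp add: algebra_simps)
  qed
  then show ?thesis using relpow_vd[OF assms(2,3)] by blast
qed

lemma vd_translate_le:
  assumes g: "g \<in> carrier G" and u: "u \<in> carrier G" and v: "v \<in> carrier G"
  shows "vd (g \<otimes> u) (g \<otimes> v) \<le> vd u v"
proof -
  have "(g \<otimes> u, g \<otimes> v) \<in> adj ^^ n" if "(u, v) \<in> adj ^^ n" for n v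
    using that
  proof (induction n arbitrary: v)
    case 0
    then show ?case by simp
  next
    case (Suc n)
    then obtain w where w: "(u, w) \<in> adj ^^ n" "(w, v) \<in> adj" by auto
    from w(2) obtain s where s: "w \<in> carrier G" "v \<in> carrier G" "s \<in> S" "v = w \<otimes> s \<or> w = v \<otimes> s"
      by (rule adjE)
    have sc: "s \<in> carrier G" using s gens by blast
    have "(g \<otimes> w, g \<otimes> v) \<in> adj"
      using adjI[of "g \<otimes> w" s] adjI[of "g \<otimes> v" s] s g sc by (auto simp: m_assoc)
    then show ?case using Suc.IH[OF w(1)] by auto
  qed
  then show ?thesis using relpow_vd[OF u v] vd_le by blast
qed

lemma vd_translate:
  assumes g: "g \<in> carrier G" and u: "u \<in> carrier G" and v: "v \<in> carrier G"
  shows "vd (g \<otimes> u) (g \<otimes> v) = vd u v"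
  using vd_translate_le[OF assms] vd_translate_le[of "inv g" "g \<otimes> u" "g \<otimes> v"] assms by simp

text \<open>Both directions are recorded because a negative power is reached by walking back from
  \<open>g \<otimes> x [^] n = \<one>\<close> to \<open>g\<close>.\<close>

lemma vd_nat_pow_le:
  assumes x: "x \<in> carrier G" and g: "g \<in> carrier G"
  shows "vd g (g \<otimes> x [^] (n::nat)) \<le> n * vd \<one> x \<and> vd (g \<otimes> x [^] n) g \<le> n * vd x \<one>"
proof (induction n)
  case 0
  then show ?case using g by simp
next
  case (Suc n)
  have e: "vd (g \<otimes> x [^] n) (g \<otimes> x [^] Suc n) = vd \<one> x" "vd (g \<otimes> x [^] Suc n) (g \<otimes> x [^] n) = vd x \<one>"
    using vd_translate[of "g \<otimes> x [^] n" \<one> x] vd_translate[of "g \<otimes> x [^] n" x \<one>] x g by (simp_all add: m_assoc)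
  show ?case
    using vd_triangle[of g "g \<otimes> x [^] n" "g \<otimes> x [^] Suc n"]
      vd_triangle[of "g \<otimes> x [^] Suc n" "g \<otimes> x [^] n" g] Suc x g e by simp
qed

lemma vd_int_pow_le:
  assumes x: "x \<in> carrier G"
  shows "int (vd \<one> (x [^] (i::int))) \<le> \<bar>i\<bar> * int (vd \<one> x + vd x \<one>)"
proof (cases "0 \<le> i")
  case True
  then obtain n where n: "i = int n" using nonneg_int_cases by blast
  have "vd \<one> (x [^] n) \<le> n * vd \<one> x"
    using vd_nat_pow_le[OF x one_closed, of n] x by simp
  also have "\<dots> \<le> n * (vd \<one> x + vd x \<one>)" by simp
  finally have "int (vd \<one> (x [^] n)) \<le> int (n * (vd \<one> x + vd x \<one>))" by linarith
  then show ?thesis using n by (simp add: int_pow_int)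
next
  case False
  then obtain n where n: "i = - int n" using int_cases2 by (metis le_minus_iff minus_zero nle_le of_nat_0_le_iff)
  have "vd \<one> (inv (x [^] n)) \<le> n * vd x \<one>"
    using vd_nat_pow_le[OF x, of "inv (x [^] n)" n] x by simp
  also have "\<dots> \<le> n * (vd \<one> x + vd x \<one>)" by simp
  finally have "int (vd \<one> (inv (x [^] n))) \<le> int (n * (vd \<one> x + vd x \<one>))" by linarith
  then show ?thesis using n x by (simp add: int_pow_neg_int)
qed

lemma exits_bounds:
  assumes "p \<in> points (cayley_graph G S)" and "(u, a) \<in> exits (cayley_graph G S) p"
  shows "0 \<le> a \<and> a \<le> 1 \<and> u \<in> carrier G \<and> vd (base_vertex (cayley_graph G S) p) u \<le> 1 \<and>
    vd u (base_vertex (cayley_graph G S) p) \<le> 1"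
proof (cases p)
  case (Vertex v)
  then have "v \<in> carrier G" "u = v" "a = 0"
    using assms by (auto simp: points_def cayley_graph_def)
  then show ?thesis using Vertex by simp
next
  case (Interior e s)
  obtain g t where e: "e = (g, t)" by fastforce
  have gt: "g \<in> carrier G" "t \<in> S" "0 < s" "s < 1"
    using assms(1) Interior e by (auto simp: points_def cayley_graph_def)
  have "u = g \<and> a = s \<or> u = g \<otimes> t \<and> a = 1 - s"
    using assms(2) Interior e by (auto simp: cayley_graph_def)
  moreover have "base_vertex (cayley_graph G S) p = g" using Interior e by (simp add: cayley_graph_def)
  ultimately show ?thesis using gt vd_generator[OF gt(1,2)] gens by auto
qed

lemma base_vertex_exit:
  assumes "p \<in> points (cayley_graph G S)"
  obtains a where "(base_vertex (cayley_graph G S) p, a) \<in> exits (cayley_graph G S) p"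
  using that by (cases p) auto

text \<open>The error 2 is one edge for each of the two points: an exit is at distance at most 1
  from its point and from the base vertex.\<close>

lemma graph_dist_bounds:
  fixes p q
  defines "\<Gamma> \<equiv> cayley_graph G S"
  defines "d \<equiv> real (vd (base_vertex \<Gamma> p) (base_vertex \<Gamma> q))"
  assumes p: "p \<in> points \<Gamma>" and q: "q \<in> points \<Gamma>"
  shows "0 \<le> graph_dist \<Gamma> p q" "graph_dist \<Gamma> p q \<le> d + 2" "d \<le> graph_dist \<Gamma> p q + 2"
proof -
  define A where "A = direct_lengths p q \<union>
    (\<lambda>((u, a), (v, b)). a + real (vd u v) + b) ` (exits \<Gamma> p \<times> exits \<Gamma> q)"
  have D: "graph_dist \<Gamma> p q = Min A" unfolding graph_dist_def A_def \<Gamma>_def ..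
  have fe: "finite (exits \<Gamma> r)" for r :: "('a, 'a \<times> 'a) graph_point" by (cases r) auto
  have fd: "finite (direct_lengths p q)" by (cases p; cases q) auto
  have fin: "finite A" unfolding A_def using fe fd by simp
  obtain a b where ab: "(base_vertex \<Gamma> p, a) \<in> exits \<Gamma> p" "(base_vertex \<Gamma> q, b) \<in> exits \<Gamma> q"
    using base_vertex_exit p q unfolding \<Gamma>_def by metis
  have "a + d + b \<in> A"
    unfolding A_def d_def using ab by force
  moreover have "a \<le> 1" "b \<le> 1" using exits_bounds ab p q unfolding \<Gamma>_def by blast+
  ultimately show "graph_dist \<Gamma> p q \<le> d + 2" using Min_le[OF fin, of "a + d + b"] D by simp
  have low: "0 \<le> m \<and> d \<le> m + 2" if m: "m \<in> A" for m
  proof (cases "m \<in> direct_lengths p q")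
    case True
    then have "0 \<le> m \<and> base_vertex \<Gamma> p = base_vertex \<Gamma> q"
      by (cases p; cases q) (auto split: if_splits)
    then show ?thesis by (simp add: d_def)
  next
    case False
    then obtain u a v b where uv: "(u, a) \<in> exits \<Gamma> p" "(v, b) \<in> exits \<Gamma> q" "m = a + real (vd u v) + b"
      using m unfolding A_def by auto
    have u: "0 \<le> a" "u \<in> carrier G" "vd (base_vertex \<Gamma> p) u \<le> 1"
      using exits_bounds uv(1) p unfolding \<Gamma>_def by blast+
    have v: "0 \<le> b" "v \<in> carrier G" "vd v (base_vertex \<Gamma> q) \<le> 1"
      using exits_bounds uv(2) q unfolding \<Gamma>_def by blast+
    have c: "base_vertex \<Gamma> p \<in> carrier G" "base_vertex \<Gamma> q \<in> carrier G"
      using exits_bounds ab p q unfolding \<Gamma>_def by blast+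
    have "vd (base_vertex \<Gamma> p) (base_vertex \<Gamma> q) \<le> vd u v + 2"
      using vd_triangle[OF c(1) u(2) c(2)] vd_triangle[OF u(2) v(2) c(2)] u(3) v(3) by linarith
    then show ?thesis using uv(3) u(1) v(1) unfolding d_def by simp
  qed
  have "Min A \<in> A" using Min_in[OF fin] \<open>a + d + b \<in> A\<close> by blast
  then show "0 \<le> graph_dist \<Gamma> p q" "d \<le> graph_dist \<Gamma> p q + 2" using low D by auto
qed

end

text \<open>Left translation reduces all pairs of vertices to distances from \<open>\<one>\<close>.
  The opposite estimate is automatic, since finitely many generators of \<open>H\<close> have
  bounded length in \<open>G\<close>. Edges are collapsed to their tails.\<close>

lemma undistortedI:
  fixes G :: "('a, 'b) monoid_scheme" (structure)
  assumes G: "group G" and H: "subgroup H G"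
    and fg: "finitely_generated_group G" "finitely_generated_group (G\<lparr>carrier := H\<rparr>)"
    and bound: "\<And>S T. finite S \<Longrightarrow> S \<subseteq> H \<Longrightarrow> generate (G\<lparr>carrier := H\<rparr>) S = H \<Longrightarrow>
      finite T \<Longrightarrow> T \<subseteq> carrier G \<Longrightarrow> generate G T = carrier G \<Longrightarrow>
      \<exists>C::nat. \<forall>h\<in>H. vertex_dist (cayley_graph (G\<lparr>carrier := H\<rparr>) S) \<one> h
        \<le> C * vertex_dist (cayley_graph G T) \<one> h"
  shows "undistorted H G"
proof -
  interpret group G by (rule G)
  have "\<exists>f. quasi_isometric_embedding (cayley_graph (G\<lparr>carrier := H\<rparr>) S) (cayley_graph G T) f \<and>
             (\<forall>h\<in>H. f (Vertex h) = Vertex h)"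
    if S: "finite S" "S \<subseteq> H" "generate (G\<lparr>carrier := H\<rparr>) S = H"
      and T: "finite T" "T \<subseteq> carrier G" "generate G T = carrier G" for S T
  proof -
    let ?H = "G\<lparr>carrier := H\<rparr>"
    let ?\<Gamma> = "cayley_graph ?H S" and ?\<Delta> = "cayley_graph G T"
    interpret T: cayley G T by unfold_locales (use T in auto)
    interpret HG: group ?H by (rule subgroup_imp_group[OF H])
    interpret S: cayley ?H S by unfold_locales (use S in auto)
    have Hc: "h \<in> carrier G" if "h \<in> H" for h using subgroup.mem_carrier[OF H that] .
    obtain C :: nat where C: "\<And>h. h \<in> H \<Longrightarrow> S.vd \<one> h \<le> C * T.vd \<one> h"
      using bound[OF S T] by blast
    have low: "S.vd u v \<le> C * T.vd u v" if "u \<in> H" "v \<in> H" for u v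
    proof -
      have i: "inv u \<in> H" "inv u \<otimes> v \<in> H"
        using subgroup.m_inv_closed[OF H] subgroup.m_closed[OF H] that by blast+
      have "S.vd \<one> (inv u \<otimes> v) = S.vd u v"
        using S.vd_translate[of "inv u" u v] that i Hc by simp
      moreover have "T.vd \<one> (inv u \<otimes> v) = T.vd u v"
        using T.vd_translate[of "inv u" u v] that Hc by simp
      ultimately show ?thesis using C[OF i(2)] by simp
    qed
    define M where "M = (\<Sum>s\<in>S. T.vd \<one> s + T.vd s \<one>)"
    have up: "T.vd u v \<le> M * S.vd u v" if u: "u \<in> H" and v: "v \<in> H" for u v
    proof -
      have "\<bar>int (T.vd u (g \<otimes> s)) - int (T.vd u g)\<bar> \<le> int M" if "g \<in> H" "s \<in> S" for g s
      proof -
        have c: "g \<in> carrier G" "s \<in> carrier G" "u \<in> carrier G" using that S Hc u by auto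
        have "T.vd g (g \<otimes> s) = T.vd \<one> s" "T.vd (g \<otimes> s) g = T.vd s \<one>"
          using T.vd_translate[of g \<one> s] T.vd_translate[of g s \<one>] c by simp_all
        moreover have "T.vd \<one> s + T.vd s \<one> \<le> M"
          unfolding M_def by (rule member_le_sum[OF that(2) _ S(1)]) simp
        ultimately show ?thesis
          using T.vd_triangle[of u g "g \<otimes> s"] T.vd_triangle[of u "g \<otimes> s" g] c by simp
      qed
      then have "\<bar>int (T.vd u v) - int (T.vd u u)\<bar> \<le> int M * int (S.vd u v)"
        using u v by (intro S.vd_lipschitz) auto
      then have "int (T.vd u v) \<le> int (M * S.vd u v)" by simp
      then show ?thesis by linarith
    qed
    \<comment> \<open>\<open>C\<close> and \<open>M\<close> are the two slopes and
      \<open>2 * M\<close> absorbs the error 2 after scaling by \<open>M\<close>. The last summand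
      gives \<open>2 \<le> K * K\<close>, needed once the factor \<open>1 / K\<close> is
      cleared.\<close>
    define K where "K = real (C + 2 * M + 2)"
    define f :: "('a, 'a \<times> 'a) graph_point \<Rightarrow> ('a, 'a \<times> 'a) graph_point"
      where "f p = Vertex (base_vertex ?\<Gamma> p)" for p
    have nt: "base_vertex ?\<Gamma> p \<in> H" if "p \<in> points ?\<Gamma>" for p
      using that by (auto simp: points_def cayley_graph_def)
    have "1 / K * graph_dist ?\<Gamma> p q - K \<le> graph_dist ?\<Delta> (f p) (f q) \<and>
        graph_dist ?\<Delta> (f p) (f q) \<le> K * graph_dist ?\<Gamma> p q + K"
      if p: "p \<in> points ?\<Gamma>" and q: "q \<in> points ?\<Gamma>" for p q
    proof -
      define D where "D = graph_dist ?\<Gamma> p q"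
      define d where "d = S.vd (base_vertex ?\<Gamma> p) (base_vertex ?\<Gamma> q)"
      define d' where "d' = T.vd (base_vertex ?\<Gamma> p) (base_vertex ?\<Gamma> q)"
      have D: "0 \<le> D" "D \<le> real d + 2" "real d \<le> D + 2"
        unfolding D_def d_def by (rule S.graph_dist_bounds[OF p q])+
      have "graph_dist ?\<Delta> (f p) (f q) = real d'"
        unfolding graph_dist_def f_def d'_def by simp
      moreover have dd: "real d \<le> real C * real d'" "real d' \<le> real M * real d"
        using low[OF nt[OF p] nt[OF q]] up[OF nt[OF p] nt[OF q]]
        unfolding d_def d'_def by (metis of_nat_le_iff of_nat_mult)+
      have K: "1 \<le> K" "real C \<le> K" "real M \<le> K" "2 * real M \<le> K" "2 \<le> K" by (simp_all add: K_def)
      have "D \<le> K * real d' + K * K"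
      proof -
        have "real C * real d' \<le> K * real d'" using K by (intro mult_right_mono) auto
        moreover have "2 * 1 \<le> K * K" using K by (intro mult_mono) auto
        ultimately show ?thesis using D dd by linarith
      qed
      then have "1 / K * D - K \<le> real d'"
        using K by (simp add: field_simps)
      moreover have "real d' \<le> K * D + K"
      proof -
        have "real M * real d \<le> real M * (D + 2)" using D by (intro mult_left_mono) auto
        moreover have "real M * D \<le> K * D" using K D by (intro mult_right_mono) auto
        ultimately show ?thesis using dd K by (simp add: algebra_simps)
      qed
      ultimately show ?thesis by (simp add: D_def)
    qed
    moreover have "f \<in> points ?\<Gamma> \<rightarrow> points ?\<Delta>"
    proof
      fix p assume "p \<in> points ?\<Gamma>"
      then have "base_vertex ?\<Gamma> p \<in> verts ?\<Delta>" using Hc nt by (simp add: cayley_graph_def[of G T])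
      then show "f p \<in> points ?\<Delta>" by (simp add: f_def points_def)
    qed
    moreover have "1 \<le> K" by (simp add: K_def)
    ultimately have "quasi_isometric_embedding ?\<Gamma> ?\<Delta> f"
      unfolding quasi_isometric_embedding_def by blast
    moreover have "\<forall>h\<in>H. f (Vertex h) = Vertex h" by (simp add: f_def)
    ultimately show ?thesis by blast
  qed
  then show ?thesis unfolding undistorted_def using H fg by blast
qed

section \<open>Slender subgroups of free-by-cyclic groups\<close>

lemma (in group) lipschitz_int_pow:
  fixes f :: "'a \<Rightarrow> int"
  assumes h: "h \<in> carrier G" and C: "\<And>g. g \<in> carrier G \<Longrightarrow> \<bar>f (g \<otimes> h) - f g\<bar> \<le> C"
  shows "\<bar>f (h [^] (q::int)) - f \<one>\<bar> \<le> C * \<bar>q\<bar>"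
proof -
  have nat: "\<bar>f (g \<otimes> h [^] n) - f g\<bar> \<le> C * int n" if g: "g \<in> carrier G" for n :: nat and g
  proof (induction n)
    case 0
    then show ?case using g by simp
  next
    case (Suc n)
    have "g \<otimes> h [^] Suc n = g \<otimes> h [^] n \<otimes> h" using g h by (simp add: m_assoc)
    then show ?case using Suc C[of "g \<otimes> h [^] n"] g h by (simp add: algebra_simps)
  qed
  show ?thesis
  proof (cases "0 \<le> q")
    case True
    then obtain n where n: "q = int n" using nonneg_int_cases by blast
    then show ?thesis using nat[OF one_closed, of n] h by (simp add: int_pow_int)
  next
    case False
    then have "0 \<le> - q" by simp
    then obtain n where "- q = int n" using nonneg_int_cases by blast
    then have n: "q = - int n" by simp
    then show ?thesis using nat[of "inv (h [^] n)" n] h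
      by (simp add: int_pow_neg_int abs_minus_commute)
  qed
qed

lemma finitely_generated_semidirect_int:
  assumes F: "group F" and \<Phi>: "\<Phi> \<in> iso F F" and fg: "finitely_generated_group F"
  shows "finitely_generated_group (semidirect_int F \<Phi>)"
proof -
  let ?G = "semidirect_int F \<Phi>"
  interpret F: group F by (rule F)
  interpret G: group ?G by (rule semidirect_int_group[OF F \<Phi>])
  have emb: "group_hom F ?G (\<lambda>x. (x, 0))"
    by unfold_locales (rule semidirect_int_embedding[OF F \<Phi>])
  have one: "aut_pow F \<Phi> n \<one>\<^bsub>F\<^esub> = \<one>\<^bsub>F\<^esub>" for n
    using hom_one[of "aut_pow F \<Phi> n" F F] aut_pow_iso[OF F \<Phi>, of n] F by (simp add: iso_def)
  obtain S where S: "finite S" "S \<subseteq> carrier F" "generate F S = carrier F"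
    using fg unfolding finitely_generated_group_def by blast
  define A where "A = insert (\<one>\<^bsub>F\<^esub>, 1) ((\<lambda>x. (x, 0::int)) ` S)"
  have A: "finite A" "A \<subseteq> carrier ?G" using S by (auto simp: A_def)
  have gA: "subgroup (generate ?G A) ?G" by (rule G.generate_is_subgroup[OF A(2)])
  have "(x, 0) \<in> generate ?G A" if "x \<in> carrier F" for x
  proof -
    have "(x, 0) \<in> generate ?G ((\<lambda>x. (x, 0)) ` S)"
      using group_hom.generate_img[OF emb, OF S(2)] S(3) that by auto
    then show ?thesis using G.mono_generate[of "(\<lambda>x. (x, 0)) ` S" A] by (auto simp: A_def)
  qed
  moreover have t: "(\<one>\<^bsub>F\<^esub>, 1) \<in> generate ?G A" by (rule generate.incl) (simp add: A_def)
  moreover have "inv\<^bsub>?G\<^esub> (\<one>\<^bsub>F\<^esub>, 1) = (\<one>\<^bsub>F\<^esub>, - 1)"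
    by (rule G.inv_equality) (simp_all add: one)
  then have t': "(\<one>\<^bsub>F\<^esub>, - 1) \<in> generate ?G A"
    using subgroup.m_inv_closed[OF gA t] by simp
  ultimately have "(x, n) \<in> generate ?G A" if x: "x \<in> carrier F" for x n
  proof (induction n rule: int_induct[where k = 0])
    case base
    then show ?case using x by blast
  next
    case (step1 i)
    then show ?case using generate.eng[of "(x, i)" ?G A "(\<one>\<^bsub>F\<^esub>, 1)"] t x by (simp add: one)
  next
    case (step2 i)
    then show ?case using generate.eng[of "(x, i)" ?G A "(\<one>\<^bsub>F\<^esub>, - 1)"] t' x by (simp add: one)
  qed
  then have "generate ?G A = carrier ?G" using G.generate_incl[OF A(2)] by auto
  then show ?thesis unfolding finitely_generated_group_def using A by blast
qed

lemma finitely_generated_fibre_subgroup: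
  assumes F: "group F" and \<Phi>: "\<Phi> \<in> iso F F"
    and H: "subgroup H (semidirect_int F \<Phi>)"
    and slender: "slender ((semidirect_int F \<Phi>)\<lparr>carrier := H\<rparr>)"
    and L: "subgroup L F" and LH: "\<And>x. x \<in> L \<Longrightarrow> (x, 0) \<in> H"
  shows "\<exists>S. finite S \<and> S \<subseteq> L \<and> generate F S = L"
proof -
  let ?G = "semidirect_int F \<Phi>"
  let ?e = "\<lambda>x. (x, 0::int)"
  interpret F: group F by (rule F)
  interpret G: group ?G by (rule semidirect_int_group[OF F \<Phi>])
  have emb: "group_hom F ?G ?e"
    by unfold_locales (rule semidirect_int_embedding[OF F \<Phi>])
  have eL: "subgroup (?e ` L) ?G" by (rule group_hom.subgroup_img_is_subgroup[OF emb L])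
  have "?e ` L \<subseteq> H" using LH by blast
  then have eLH: "subgroup (?e ` L) (?G\<lparr>carrier := H\<rparr>)" by (rule G.subgroup_incl[OF eL H])
  have "finitely_generated_group (?G\<lparr>carrier := ?e ` L\<rparr>)"
    using slender eLH unfolding slender_def by fastforce
  then obtain S' where S': "finite S'" "S' \<subseteq> ?e ` L" "generate (?G\<lparr>carrier := ?e ` L\<rparr>) S' = ?e ` L"
    unfolding finitely_generated_group_def by auto
  obtain S where S: "S \<subseteq> L" "finite S" "S' = ?e ` S" using finite_subset_image[OF S'(1,2)] by blast
  have SF: "S \<subseteq> carrier F" using S(1) subgroup.subset[OF L] by blast
  have "?e ` generate F S = ?e ` L"
    using group_hom.generate_img[OF emb, OF SF] G.generate_consistent[OF S'(2) eL] S'(3) S(3) by simp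
  moreover have "inj ?e" by (simp add: inj_on_def)
  ultimately have "generate F S = L" by (metis inj_image_eq_iff)
  then show ?thesis using S by blast
qed

theorem lemma4p2:
  fixes F :: "('a, 'b) monoid_scheme" and \<Phi> :: "'a \<Rightarrow> 'a" and H :: "('a \<times> int) set"
  assumes "free_group F" and "finitely_generated_group F" and "\<not> cyclic_group F"
    and "\<Phi> \<in> iso F F"
    and "subgroup H (semidirect_int F \<Phi>)"
    and "slender ((semidirect_int F \<Phi>)\<lparr>carrier := H\<rparr>)"
  shows "undistorted H (semidirect_int F \<Phi>)"
proof -
  let ?G = "semidirect_int F \<Phi>"
  let ?H = "?G\<lparr>carrier := H\<rparr>"
  note \<Phi> = assms(4) and H = assms(5)
  obtain X where X: "free_basis F X" and F: "group F" using assms(1) unfolding free_group_def by blast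
  interpret free_group_basis F X by (intro free_group_basis.intro free_group_basis_axioms.intro F X)
  interpret G: group ?G by (rule semidirect_int_group[OF F \<Phi>])
  have emb: "group_hom F ?G (\<lambda>x. (x, 0))"
    by unfold_locales (rule semidirect_int_embedding[OF F \<Phi>])
  have finX: "finite X" by (rule finite_basis[OF assms(2)])
  have Hc: "h \<in> carrier ?G" if "h \<in> H" for h using subgroup.mem_carrier[OF H that] .
  have Hpow: "h [^]\<^bsub>?G\<^esub> (i::int) \<in> H" if "h \<in> H" for h i
    by (rule G.subgroup_int_pow_closed[OF H that])

  define K where "K = {x \<in> carrier F. (x, 0) \<in> H}"
  have K: "subgroup K F"
  proof (rule subgroupI)
    show "K \<subseteq> carrier F" "K \<noteq> {}" using subgroup.one_closed[OF H] by (auto simp: K_def)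
    show "inv\<^bsub>F\<^esub> a \<in> K" if "a \<in> K" for a
      using subgroup.m_inv_closed[OF H, of "(a, 0)"] group_hom.hom_inv[OF emb, of a] that by (simp add: K_def)
    show "a \<otimes>\<^bsub>F\<^esub> b \<in> K" if "a \<in> K" "b \<in> K" for a b
      using subgroup.m_closed[OF H, of "(a, 0)" "(b, 0)"] that
      by (simp add: K_def aut_pow_0[OF F \<Phi>])
  qed
  have "\<exists>x\<in>K. \<forall>k\<in>K. \<exists>i::int. k = x [^]\<^bsub>F\<^esub> i"
    using finitely_generated_fibre_subgroup[OF F \<Phi> H assms(6)]
    by (intro noetherian_subgroup_cyclic[OF K]) (auto simp: K_def)
  then obtain x where x: "x \<in> K" "\<And>k. k \<in> K \<Longrightarrow> \<exists>i::int. k = x [^]\<^bsub>F\<^esub> i" by blast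
  have xF: "x \<in> carrier F" and xH: "(x, 0) \<in> H" using x by (simp_all add: K_def)

  have snd_mult: "snd (a \<otimes>\<^bsub>?G\<^esub> b) = snd a + snd b" for a b by (cases a; cases b) simp
  obtain h0 where h0: "h0 \<in> H" "\<And>h. h \<in> H \<Longrightarrow> \<exists>q. snd h = q * snd h0 \<and> \<bar>q\<bar> \<le> \<bar>snd h\<bar>"
    using G.int_hom_generator[OF H, of snd] snd_mult by blast
  have snd_pow: "snd (h [^]\<^bsub>?G\<^esub> (q::int)) = q * snd h" if "h \<in> H" for h q
    by (rule G.int_hom_int_pow[OF H snd_mult that])
  \<comment> \<open>For trivial \<open>x\<close> no function can detect the exponent, so it is
    normalised to 0 here and a constant function takes the place of \<open>\<phi>\<close>
    below.\<close>
  have decomp: "\<exists>i q. h = (x, 0) [^]\<^bsub>?G\<^esub> (i::int) \<otimes>\<^bsub>?G\<^esub> h0 [^]\<^bsub>?G\<^esub> (q::int) \<and>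
      \<bar>q\<bar> \<le> \<bar>snd h\<bar> \<and> (x = \<one>\<^bsub>F\<^esub> \<longrightarrow> i = 0)" if h: "h \<in> H" for h
  proof -
    obtain q where q: "snd h = q * snd h0" "\<bar>q\<bar> \<le> \<bar>snd h\<bar>" using h0(2)[OF h] by blast
    define k where "k = fst (h \<otimes>\<^bsub>?G\<^esub> h0 [^]\<^bsub>?G\<^esub> (- q))"
    have "h \<otimes>\<^bsub>?G\<^esub> h0 [^]\<^bsub>?G\<^esub> (- q) \<in> H" using subgroup.m_closed[OF H h Hpow[OF h0(1)]] .
    moreover have k: "h \<otimes>\<^bsub>?G\<^esub> h0 [^]\<^bsub>?G\<^esub> (- q) = (k, 0)"
      using snd_mult[of h] snd_pow[OF h0(1), of "- q"] q(1) by (simp add: prod_eq_iff k_def)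
    ultimately have kK: "k \<in> K" using Hc by (auto simp: K_def)
    have "\<exists>i::int. k = x [^]\<^bsub>F\<^esub> i \<and> (x = \<one>\<^bsub>F\<^esub> \<longrightarrow> i = 0)"
    proof (cases "x = \<one>\<^bsub>F\<^esub>")
      case True
      then show ?thesis using x(2)[OF kK] by (intro exI[of _ 0]) auto
    next
      case False
      then show ?thesis using x(2)[OF kK] by blast
    qed
    then obtain i :: int where i: "k = x [^]\<^bsub>F\<^esub> i" "x = \<one>\<^bsub>F\<^esub> \<longrightarrow> i = 0" by blast
    have "(k, 0) = (x, 0) [^]\<^bsub>?G\<^esub> i" using group_hom.hom_int_pow[OF emb, OF xF, of i] i by simp
    then have "h \<otimes>\<^bsub>?G\<^esub> inv\<^bsub>?G\<^esub> (h0 [^]\<^bsub>?G\<^esub> q) = (x, 0) [^]\<^bsub>?G\<^esub> i"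
      using k G.int_pow_neg[OF Hc[OF h0(1)]] by simp
    then have "h = (x, 0) [^]\<^bsub>?G\<^esub> i \<otimes>\<^bsub>?G\<^esub> h0 [^]\<^bsub>?G\<^esub> q"
      using G.inv_solve_right'[of "(x, 0) [^]\<^bsub>?G\<^esub> i" h "h0 [^]\<^bsub>?G\<^esub> q"] Hc[OF h] Hc[OF Hpow[OF h0(1)]]
        Hc[OF Hpow[OF xH]] by metis
    then show ?thesis using q(2) i(2) by blast
  qed

  have lip: "\<exists>\<phi> :: 'a \<times> int \<Rightarrow> int.
    (x \<noteq> \<one>\<^bsub>F\<^esub> \<longrightarrow> (\<forall>g\<in>carrier ?G. \<phi> ((x, 0) \<otimes>\<^bsub>?G\<^esub> g) = \<phi> g + 1)) \<and>
    (\<forall>a\<in>carrier ?G. \<exists>C. \<forall>g\<in>carrier ?G. \<bar>\<phi> (g \<otimes>\<^bsub>?G\<^esub> a) - \<phi> g\<bar> \<le> C)"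
  proof (cases "x = \<one>\<^bsub>F\<^esub>")
    case True
    then show ?thesis by (intro exI[of _ "\<lambda>_. 0"]) auto
  next
    case False
    then show ?thesis
      using ex_equivariant_lipschitz[OF free_group_basis_axioms finX \<Phi> xF False] by blast
  qed
  then obtain \<phi> :: "'a \<times> int \<Rightarrow> int" and C where
    \<phi>: "\<And>g. x \<noteq> \<one>\<^bsub>F\<^esub> \<Longrightarrow> g \<in> carrier ?G \<Longrightarrow> \<phi> ((x, 0) \<otimes>\<^bsub>?G\<^esub> g) = \<phi> g + 1"
    and C: "\<And>a g. a \<in> carrier ?G \<Longrightarrow> g \<in> carrier ?G \<Longrightarrow> \<bar>\<phi> (g \<otimes>\<^bsub>?G\<^esub> a) - \<phi> g\<bar> \<le> C a"
    by metis

  have "\<exists>c::nat. \<forall>h\<in>H. vertex_dist (cayley_graph ?H S) \<one>\<^bsub>?G\<^esub> h \<le>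
      c * vertex_dist (cayley_graph ?G T) \<one>\<^bsub>?G\<^esub> h"
    if S: "S \<subseteq> H" "generate ?H S = H"
      and T: "finite T" "T \<subseteq> carrier ?G" "generate ?G T = carrier ?G" for S T
  proof -
    interpret HG: group ?H by (rule G.subgroup_imp_group[OF H])
    interpret S: cayley ?H S by unfold_locales (use S in auto)
    interpret T: cayley ?G T by unfold_locales (use T in auto)
    \<comment> \<open>\<open>C1\<close> and \<open>C2\<close> are Lipschitz constants with respect
      to \<open>T\<close> of the projection to the integers and of \<open>\<phi>\<close>;
      \<open>a\<close> and \<open>b\<close> are the costs in \<open>S\<close> of one factor
      \<open>(x, 0)\<close> or \<open>h0\<close>, of either sign.\<close>
    define C1 where "C1 = (\<Sum>t\<in>T. \<bar>snd t\<bar>)"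
    define C2 where "C2 = (\<Sum>t\<in>T. \<bar>C t\<bar>)"
    define a where "a = int (S.vd \<one>\<^bsub>?H\<^esub> (x, 0) + S.vd (x, 0) \<one>\<^bsub>?H\<^esub>)"
    define b where "b = int (S.vd \<one>\<^bsub>?H\<^esub> h0 + S.vd h0 \<one>\<^bsub>?H\<^esub>)"
    define c where "c = (C2 + \<bar>C h0\<bar> * C1) * a + C1 * b"
    have nn: "0 \<le> C1" "0 \<le> C2" "0 \<le> a" "0 \<le> b"
      by (simp_all add: C1_def C2_def a_def b_def sum_nonneg)
    have "int (S.vd \<one>\<^bsub>?G\<^esub> h) \<le> c * int (T.vd \<one>\<^bsub>?G\<^esub> h)" if h: "h \<in> H" for h
    proof -
      let ?d = "int (T.vd \<one>\<^bsub>?G\<^esub> h)"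
      obtain i q where iq: "h = (x, 0) [^]\<^bsub>?G\<^esub> (i::int) \<otimes>\<^bsub>?G\<^esub> h0 [^]\<^bsub>?G\<^esub> (q::int)"
        "\<bar>q\<bar> \<le> \<bar>snd h\<bar>" "x = \<one>\<^bsub>F\<^esub> \<longrightarrow> i = 0" using decomp[OF h] by blast
      have "\<bar>snd h - snd \<one>\<^bsub>?G\<^esub>\<bar> \<le> C1 * ?d"
      proof (rule T.vd_lipschitz)
        show "\<bar>snd (g \<otimes>\<^bsub>?G\<^esub> t) - snd g\<bar> \<le> C1" if "t \<in> T" for g t
          unfolding C1_def snd_mult using member_le_sum[OF that _ T(1), of "\<lambda>t. \<bar>snd t\<bar>"] by simp
      qed (use Hc[OF h] in auto)
      then have q: "\<bar>q\<bar> \<le> C1 * ?d" using iq(2) by simp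
      \<comment> \<open>By equivariance \<open>i\<close> is the difference of the values of
        \<open>\<phi>\<close> at \<open>h\<close> and at the power of \<open>h0\<close>. Both are
        compared with the value at the identity: the first differs by at most
        \<open>C2 * ?d\<close>, the second by at most \<open>\<bar>C h0\<bar>\<close> times the
        bound on \<open>q\<close>.\<close>
      have "\<bar>i\<bar> \<le> (C2 + \<bar>C h0\<bar> * C1) * ?d"
      proof (cases "x = \<one>\<^bsub>F\<^esub>")
        case True
        then show ?thesis using iq(3) nn by simp
      next
        case False
        have "\<bar>\<phi> h - \<phi> \<one>\<^bsub>?G\<^esub>\<bar> \<le> C2 * ?d"
        proof (rule T.vd_lipschitz)
          show "\<bar>\<phi> (g \<otimes>\<^bsub>?G\<^esub> t) - \<phi> g\<bar> \<le> C2" if "g \<in> carrier ?G" "t \<in> T" for g t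
          proof -
            have "\<bar>\<phi> (g \<otimes>\<^bsub>?G\<^esub> t) - \<phi> g\<bar> \<le> C t" using C[of t g] that T(2) by blast
            also have "\<dots> \<le> \<bar>C t\<bar>" by simp
            also have "\<dots> \<le> C2"
              unfolding C2_def using member_le_sum[OF that(2) _ T(1), of "\<lambda>t. \<bar>C t\<bar>"] by simp
            finally show ?thesis .
          qed
        qed (use Hc[OF h] in auto)
        moreover have "\<phi> h = \<phi> (h0 [^]\<^bsub>?G\<^esub> q) + i"
          unfolding iq(1)
          by (rule G.equivariant_int_pow[where \<psi> = \<phi>, OF Hc[OF xH] \<phi>[OF False] Hc[OF Hpow[OF h0(1)]]])
        moreover have "\<bar>\<phi> (h0 [^]\<^bsub>?G\<^esub> q) - \<phi> \<one>\<^bsub>?G\<^esub>\<bar> \<le> C h0 * \<bar>q\<bar>"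
          by (rule G.lipschitz_int_pow[where f = \<phi>, OF Hc[OF h0(1)] C[OF Hc[OF h0(1)]]])
        moreover have "C h0 * \<bar>q\<bar> \<le> \<bar>C h0\<bar> * (C1 * ?d)"
          using q by (intro mult_mono) auto
        ultimately show ?thesis by (simp only: distrib_right mult.assoc)
      qed
      then have "\<bar>i\<bar> * a \<le> (C2 + \<bar>C h0\<bar> * C1) * ?d * a" using nn by (intro mult_right_mono)
      moreover have "\<bar>q\<bar> * b \<le> C1 * ?d * b" using q nn by (intro mult_right_mono)
      moreover have "int (S.vd \<one>\<^bsub>?G\<^esub> h) \<le> \<bar>i\<bar> * a + \<bar>q\<bar> * b"
      proof -
        let ?X = "(x, 0) [^]\<^bsub>?G\<^esub> i" and ?Q = "h0 [^]\<^bsub>?G\<^esub> q"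
        have XQ: "?X \<in> H" "?Q \<in> H" using Hpow xH h0(1) by blast+
        have "S.vd \<one>\<^bsub>?G\<^esub> h \<le> S.vd \<one>\<^bsub>?G\<^esub> ?X + S.vd ?X h"
          using S.vd_triangle[of "\<one>\<^bsub>?G\<^esub>" ?X h] XQ h subgroup.one_closed[OF H] by simp
        moreover have "S.vd ?X h = S.vd \<one>\<^bsub>?G\<^esub> ?Q"
          using S.vd_translate[of ?X "\<one>\<^bsub>?G\<^esub>" ?Q] XQ subgroup.one_closed[OF H] G.r_one[OF Hc[OF XQ(1)]] iq(1)
          by simp
        moreover have "int (S.vd \<one>\<^bsub>?G\<^esub> ?X) \<le> \<bar>i\<bar> * a"
          using S.vd_int_pow_le[of "(x, 0)" i] xH G.int_pow_consistent[OF H xH, of i] by (simp add: a_def)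
        moreover have "int (S.vd \<one>\<^bsub>?G\<^esub> ?Q) \<le> \<bar>q\<bar> * b"
          using S.vd_int_pow_le[of h0 q] h0(1) G.int_pow_consistent[OF H h0(1), of q] by (simp add: b_def)
        ultimately show ?thesis by linarith
      qed
      ultimately show ?thesis unfolding c_def by (simp add: algebra_simps)
    qed
    moreover have "0 \<le> c" using nn by (simp add: c_def)
    ultimately have "\<forall>h\<in>H. S.vd \<one>\<^bsub>?G\<^esub> h \<le> nat c * T.vd \<one>\<^bsub>?G\<^esub> h"
      by (metis int_nat_eq of_nat_le_iff of_nat_mult)
    then show ?thesis by blast
  qed
  moreover have "finitely_generated_group ?H"
    using assms(6) G.subgroup_incl[OF H H] unfolding slender_def by fastforce
  ultimately show ?thesis
    by (intro undistortedI G.is_group H finitely_generated_semidirect_int[OF F \<Phi> assms(2)])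
qed

end
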